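(* Let $S$ be a Morse tiled (resp. Morse shelled) set. Then the first barycentric subdivision of $S$ carries tame Morse tilings (resp. tame Morse shellings) containing the same number of critical tiles, with the same indices, as the given tiling (resp. shelling) of $S$.
   Context: A facet of a simplex is a codimension one face. A Morse tile of dimension $n$ and order $k\in\{0,\dots,n+1\}$ is a closed $n$-simplex $\sigma$ (its underlying simplex) deprived of $k$ of its facets together with, if $k\ge 1$, a possibly empty face $\mu$ of codimension at least two (the Morse face); when $\mu$ is non-empty it is understood not to be contained in the removed facets, so that $k-1\le\dim\mu\le n-2$. Critical tiles: the closed simplex is critical of index $0$; the open $n$-simplex (order $n+1$) is critical of index $n$; a Morse tile of order $k$, $1\le k\le n-1$, whose Morse face has dimension $k-1$ is critical of index $k$; all other Morse tiles are regular. Let $K$ be a finite simplicial complex. A Morse tiling of a subset $S\subset|K|$ is a partition of $S$ by Morse tiles, each obtained from a simplex of $K$, such that for every $j\ge 0$ the union of the tiles of dimension $\ge j$ is closed in $S$; the closure of $S$ in $K$ is called the underlying simplicial complex. A Morse tiled subset of $S$ is a union of tiles closed in $S$. A Morse shelling of $S$ is a Morse tiling together with a filtration $\emptyset\subset S_1\subset\dots\subset S_N=S$ by Morse tiled subsets such that $S_1$ and each $S_i\setminus S_{i-1}$ ($2\le i\le N$) is a single tile. A Morse tiled (shelled) set is a set equipped with a Morse tiling (shelling). The first barycentric subdivision of $S$ is the same subset $S$, regarded as a subset of the first barycentric subdivision of its underlying simplicial complex. A Morse tiling (or shelling) is tame if there is an orientation of all edges of the underlying simplicial complex such that (1) no triangle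 of the complex has boundary an oriented one-cycle; (2) for every tile with underlying simplex $\sigma$ and non-empty Morse face $\mu$, all edges joining a vertex of $\sigma$ not in $\mu$ to a vertex of $\mu$ are oriented towards $\mu$. *)

theory Defs
  imports "HOL-Analysis.Analysis"
begin

text \<open>
  Finite simplicial complexes are geometric ones, in a Euclidean space of arbitrary dimension:
  \<^const>\<open>simplicial_complex\<close> and \<^const>\<open>simplex\<close> from the polytope library. Their complexes
  contain the empty simplex, of dimension \<open>-1\<close>.
\<close>

text \<open>
  Unlike \<^const>\<open>facet_of\<close>, the following admits the empty face as the facet of a point, so that
  orders \<open>0\<close> and \<open>1\<close> are both possible in dimension \<open>0\<close> (and give the same set).
\<close>

definition simplex_facets :: "'a::euclidean_space set \<Rightarrow> 'a set set" where
  "simplex_facets \<sigma> = {F. F face_of \<sigma> \<and> aff_dim F = aff_dim \<sigma> - 1}"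

text \<open>
  \<open>morse_tile_of n k \<sigma> \<mu> t\<close>: the set \<open>t\<close> is a Morse tile of dimension \<open>n\<close> and order \<open>k\<close>, with
  underlying simplex \<open>\<sigma>\<close> and (possibly empty) Morse face \<open>\<mu>\<close>. For \<open>n \<ge> 1\<close> the set \<open>t\<close>
  determines \<open>n\<close>, \<open>k\<close>, \<open>\<sigma>\<close> and \<open>\<mu>\<close>; for \<open>n = 0\<close> it determines all but \<open>k\<close>.
\<close>

definition morse_tile_of ::
    "nat \<Rightarrow> nat \<Rightarrow> 'a::euclidean_space set \<Rightarrow> 'a set \<Rightarrow> 'a set \<Rightarrow> bool" where
  "morse_tile_of n k \<sigma> \<mu> t \<longleftrightarrow>
     int n simplex \<sigma> \<and>
     (\<exists>\<F>. \<F> \<subseteq> simplex_facets \<sigma> \<and> card \<F> = k \<and>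
          \<mu> face_of \<sigma> \<and>
          (\<mu> \<noteq> {} \<longrightarrow> 1 \<le> k \<and> aff_dim \<mu> \<le> int n - 2 \<and> (\<forall>F\<in>\<F>. \<not> \<mu> \<subseteq> F)) \<and>
          t = \<sigma> - (\<Union>\<F> \<union> \<mu>))"

definition critical_tile :: "'a::euclidean_space set \<Rightarrow> nat \<Rightarrow> bool" where
  "critical_tile t i \<longleftrightarrow>
     (\<exists>n k \<sigma> \<mu>. morse_tile_of n k \<sigma> \<mu> t \<and>
        (k = 0 \<and> i = 0 \<or>
         k = n + 1 \<and> i = n \<or>
         1 \<le> k \<and> k < n \<and> aff_dim \<mu> = int k - 1 \<and> i = k))"

definition morse_tiling ::
    "'a::euclidean_space set set \<Rightarrow> 'a set \<Rightarrow> 'a set set \<Rightarrow> bool" where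
  "morse_tiling K S T \<longleftrightarrow>
     simplicial_complex K \<and> S \<subseteq> \<Union>K \<and>
     partition_on S T \<and>
     (\<forall>t\<in>T. \<exists>n k. \<exists>\<sigma>\<in>K. \<exists>\<mu>. morse_tile_of n k \<sigma> \<mu> t) \<and>
     (\<forall>j. closedin (top_of_set S) (\<Union>{t\<in>T. \<exists>n\<ge>j. \<exists>k \<sigma> \<mu>. morse_tile_of n k \<sigma> \<mu> t}))"

definition morse_tiled_subset ::
    "'a::euclidean_space set \<Rightarrow> 'a set set \<Rightarrow> 'a set \<Rightarrow> bool" where
  "morse_tiled_subset S T A \<longleftrightarrow> (\<exists>U\<subseteq>T. A = \<Union>U) \<and> closedin (top_of_set S) A"

text \<open>Only the values \<open>A 1, \<dots>, A N\<close> of the filtration \<open>A\<close> matter.\<close>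

definition morse_shelling ::
    "'a::euclidean_space set set \<Rightarrow> 'a set \<Rightarrow> 'a set set \<Rightarrow> nat \<Rightarrow> (nat \<Rightarrow> 'a set) \<Rightarrow> bool" where
  "morse_shelling K S T N A \<longleftrightarrow>
     morse_tiling K S T \<and> 1 \<le> N \<and>
     (\<forall>i\<in>{1..N}. morse_tiled_subset S T (A i)) \<and>
     A 1 \<in> T \<and>
     (\<forall>i\<in>{2..N}. A (i - 1) \<subset> A i \<and> A i - A (i - 1) \<in> T) \<and>
     A N = S"

text \<open>
  The closure of \<open>S\<close> in \<open>K\<close>, as a complex. A tile is dense in its underlying simplex, so for a
  tiled set these are the simplices of \<open>K\<close> that are faces of underlying simplices of tiles.
\<close>

definition underlying_complex ::
    "'a::euclidean_space set set \<Rightarrow> 'a set \<Rightarrow> 'a set set" where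
  "underlying_complex K S = {\<sigma>\<in>K. \<sigma> \<subseteq> closure S}"

definition barycenter :: "'a::euclidean_space set \<Rightarrow> 'a" where
  "barycenter \<sigma> =
     (\<Sum>v | v extreme_point_of \<sigma>. v) /\<^sub>R real (card {v. v extreme_point_of \<sigma>})"

definition barycentric_subdivision :: "'a::euclidean_space set set \<Rightarrow> 'a set set" where
  "barycentric_subdivision L =
     {convex hull (barycenter ` C) | C. C \<subseteq> L - {{}} \<and> chain_subset C}"

text \<open>
  An orientation of the edges of \<open>L\<close>: \<open>R v w\<close> says that the edge \<open>vw\<close> is oriented from \<open>v\<close>
  to \<open>w\<close>. Values of \<open>R\<close> on pairs that do not span an edge are irrelevant.
\<close>

definition edge_orientation ::
    "'a::euclidean_space set set \<Rightarrow> ('a \<Rightarrow> 'a \<Rightarrow> bool) \<Rightarrow> bool" where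
  "edge_orientation L R \<longleftrightarrow>
     (\<forall>v w. v \<noteq> w \<and> closed_segment v w \<in> L \<longrightarrow> (R v w \<longleftrightarrow> \<not> R w v))"

definition tame_tiling ::
    "'a::euclidean_space set set \<Rightarrow> 'a set \<Rightarrow> 'a set set \<Rightarrow> bool" where
  "tame_tiling K S T \<longleftrightarrow>
     (\<exists>R. edge_orientation (underlying_complex K S) R \<and>
        (\<forall>\<tau> u v w. \<tau> \<in> underlying_complex K S \<and> 2 simplex \<tau> \<and>
           {x. x extreme_point_of \<tau>} = {u, v, w} \<longrightarrow> \<not> (R u v \<and> R v w \<and> R w u)) \<and>
        (\<forall>t\<in>T. \<forall>n k \<sigma> \<mu>. morse_tile_of n k \<sigma> \<mu> t \<and> \<mu> \<noteq> {} \<longrightarrow>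
           (\<forall>v w. v extreme_point_of \<sigma> \<and> v \<notin> \<mu> \<and> w extreme_point_of \<mu> \<longrightarrow> R v w)))"

end

theory Submission
  imports Defs "HOL-Combinatorics.Multiset_Permutations"
begin

text \<open>
  Each tile is subdivided on its own, without reference to its neighbours. Let \<open>V\<close> be the vertex
  set of the underlying simplex, \<open>R\<close> the set of vertices opposite to the removed facets and \<open>M\<close> the
  vertex set of the Morse face. In terms of barycentric coordinates \<open>u\<close>, a point of the simplex
  belongs to the tile iff \<open>u\<close> is positive on \<open>R\<close> and somewhere outside \<open>M\<close>.

  The maximal simplices of the subdivision correspond to the orderings \<open>p\<close> of \<open>V\<close>: the vertices are
  the centroids of the initial segments of \<open>p\<close>, and a point lies in that simplex iff \<open>u\<close> is weakly
  decreasing along \<open>p\<close>. Rank the vertices so that \<open>M - R\<close> comes first, then \<open>V - M\<close>, and \<open>R\<close> last,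
  and send a point of the tile to the ordering obtained by sorting \<open>V\<close> by decreasing \<open>u\<close>, ties being
  broken by increasing rank. The fibres of this map partition the tile, and each fibre is itself a
  Morse tile (\<open>piece_eq_tile\<close>). Its removed facets are given by the descents of \<open>p\<close>, together with
  the last position if the last vertex lies in \<open>R\<close>; its Morse face is spanned by the initial segments
  which precede the first vertex outside \<open>M\<close>, provided that all descents lie there and the last
  vertex is not in \<open>R\<close>. The choice of the ranking is what makes the count of critical pieces right:
  in the ordering of a critical piece \<open>R\<close> comes first, with decreasing ranks, followed by \<open>V - R\<close> with
  increasing ranks, and this single ordering gives a critical piece iff the tile is critical, with the same index
  (\<open>critical_piece_data_iff\<close>).

  If a point of the tile lies in the simplex of \<open>p\<close>, then its own ordering has no inversion that \<open>p\<close>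
  does not have. Hence listing the orderings by their number of inversions gives a shelling of the
  tile (\<open>closedin_Union_pieces\<close>), and concatenating these shellings along a shelling of \<open>S\<close> gives a
  shelling of \<open>S\<close>. All pieces of a tile have the dimension of the tile, so the closedness conditions
  of a tiling are inherited.

  Orient an edge of the subdivision from the centroid of the larger simplex to that of the smaller one.
  This is a strict partial order on vertices, hence has no oriented cycles, and the Morse faces point
  the right way because they are spanned by initial segments of orderings.
\<close>

section \<open>Barycentric coordinates and level sets\<close>

text \<open>
  The coordinates are made total by putting them equal to \<open>0\<close> outside \<open>V\<close>. In this way the coordinates
  of a point with respect to a simplex and to any of its faces are literally the same function.
\<close>

definition bcoord :: "'a::euclidean_space set \<Rightarrow> 'a \<Rightarrow> 'a \<Rightarrow> real" where
  "bcoord V x = (SOME u. (\<forall>v. v \<notin> V \<longrightarrow> u v = 0) \<and> sum u V = 1 \<and> (\<Sum>v\<in>V. u v *\<^sub>R v) = x)"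

text \<open>
  Two families of coordinates of the same point differ by an affine relation among the vertices.
\<close>

lemma bcoord_eqI:
  assumes V: "\<not> affine_dependent V"
    and u: "\<And>v. v \<notin> V \<Longrightarrow> u v = 0" "sum u V = 1" "(\<Sum>v\<in>V. u v *\<^sub>R v) = x"
  shows "bcoord V x = u"
proof -
  have fin: "finite V" using V by (rule aff_independent_finite)
  define P where "P = (\<lambda>u. (\<forall>v. v \<notin> V \<longrightarrow> u v = 0) \<and> sum u V = 1 \<and> (\<Sum>v\<in>V. u v *\<^sub>R v) = x)"
  have "P u" using u by (simp add: P_def)
  have uniq: "w = u" if "P w" for w
  proof
    fix v
    have "sum (\<lambda>v. w v - u v) V = 0" "(\<Sum>v\<in>V. (w v - u v) *\<^sub>R v) = 0"
      using \<open>P u\<close> \<open>P w\<close> by (auto simp: P_def sum_subtractf scaleR_left_diff_distrib)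
    then have "\<forall>v\<in>V. w v - u v = 0"
      using V fin affine_dependent_explicit_finite[of V] by blast
    then show "w v = u v"
      using \<open>P u\<close> \<open>P w\<close> by (cases "v \<in> V") (auto simp: P_def)
  qed
  have "(SOME u. P u) = u" using \<open>P u\<close> uniq by (rule some_equality)
  then show ?thesis by (simp add: bcoord_def P_def)
qed

lemma bcoord_convex_hull:
  assumes V: "\<not> affine_dependent V" and x: "x \<in> convex hull V"
  shows "\<And>v. 0 \<le> bcoord V x v" "\<And>v. v \<notin> V \<Longrightarrow> bcoord V x v = 0"
    "sum (bcoord V x) V = 1" "(\<Sum>v\<in>V. bcoord V x v *\<^sub>R v) = x"
proof -
  have fin: "finite V" using V by (rule aff_independent_finite)
  obtain u where u: "\<forall>v\<in>V. 0 \<le> u v" "sum u V = 1" "(\<Sum>v\<in>V. u v *\<^sub>R v) = x"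
    using x by (auto simp: convex_hull_finite[OF fin])
  define w where "w = (\<lambda>v. if v \<in> V then u v else 0)"
  have "sum w V = sum u V" by (rule sum.cong) (auto simp: w_def)
  then have w: "\<And>v. v \<notin> V \<Longrightarrow> w v = 0" "sum w V = 1" "(\<Sum>v\<in>V. w v *\<^sub>R v) = x"
    using u by (auto simp: w_def)
  then have "bcoord V x = w" using bcoord_eqI[OF V] by blast
  then show "\<And>v. 0 \<le> bcoord V x v" "\<And>v. v \<notin> V \<Longrightarrow> bcoord V x v = 0"
    "sum (bcoord V x) V = 1" "(\<Sum>v\<in>V. bcoord V x v *\<^sub>R v) = x"
    using w u by (auto simp: w_def)
qed

lemma bcoord_subset:
  assumes V: "\<not> affine_dependent V" and "W \<subseteq> V" and x: "x \<in> convex hull W"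
  shows "bcoord V x = bcoord W x"
proof -
  have W: "\<not> affine_dependent W" using V \<open>W \<subseteq> V\<close> affine_dependent_subset by blast
  have fin: "finite V" using V by (rule aff_independent_finite)
  note c = bcoord_convex_hull[OF W x]
  have "sum (bcoord W x) V = sum (bcoord W x) W"
    by (rule sum.mono_neutral_right) (use fin \<open>W \<subseteq> V\<close> c in auto)
  moreover have "(\<Sum>v\<in>V. bcoord W x v *\<^sub>R v) = (\<Sum>v\<in>W. bcoord W x v *\<^sub>R v)"
    by (rule sum.mono_neutral_right) (use fin \<open>W \<subseteq> V\<close> c in auto)
  ultimately show ?thesis using c \<open>W \<subseteq> V\<close> by (intro bcoord_eqI[OF V]) auto
qed

text \<open>
  Membership in a face is a condition on the support of the coordinates.
\<close>

lemma mem_hull_subset_iff: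
  assumes V: "\<not> affine_dependent V" and "W \<subseteq> V" and x: "x \<in> convex hull V"
  shows "x \<in> convex hull W \<longleftrightarrow> {v. 0 < bcoord V x v} \<subseteq> W"
proof
  assume "x \<in> convex hull W"
  then have "bcoord V x = bcoord W x" using bcoord_subset V \<open>W \<subseteq> V\<close> by blast
  moreover have "\<not> affine_dependent W" using V \<open>W \<subseteq> V\<close> affine_dependent_subset by blast
  ultimately show "{v. 0 < bcoord V x v} \<subseteq> W"
    using bcoord_convex_hull(2)[OF _ \<open>x \<in> convex hull W\<close>] by fastforce
next
  have fin: "finite V" "finite W"
    using V \<open>W \<subseteq> V\<close> by (auto intro: aff_independent_finite finite_subset)
  assume supp: "{v. 0 < bcoord V x v} \<subseteq> W"
  note c = bcoord_convex_hull[OF V x]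
  have z: "bcoord V x v = 0" if "v \<notin> W" for v using c(1)[of v] supp that by (auto simp: less_le)
  have "sum (bcoord V x) W = sum (bcoord V x) V"
    by (rule sum.mono_neutral_left) (use fin \<open>W \<subseteq> V\<close> z in auto)
  moreover have "(\<Sum>v\<in>W. bcoord V x v *\<^sub>R v) = (\<Sum>v\<in>V. bcoord V x v *\<^sub>R v)"
    by (rule sum.mono_neutral_left) (use fin \<open>W \<subseteq> V\<close> z in auto)
  ultimately show "x \<in> convex hull W" using c fin by (auto simp: convex_hull_finite)
qed

text \<open>
  The barycenter of a simplex in terms of its vertex set.
\<close>

definition centroid :: "'a::euclidean_space set \<Rightarrow> 'a" where
  "centroid W = (\<Sum>v\<in>W. v) /\<^sub>R real (card W)"

lemma barycenter_hull:
  assumes "\<not> affine_dependent W"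
  shows "barycenter (convex hull W) = centroid W"
proof -
  have "{v. v extreme_point_of convex hull W} = W"
    using extreme_point_of_convex_hull_affine_independent[OF assms] by auto
  then show ?thesis by (simp add: barycenter_def centroid_def)
qed

lemma centroid_in_hull:
  assumes "finite W" "W \<noteq> {}"
  shows "centroid W \<in> convex hull W"
proof -
  have "centroid W = (\<Sum>v\<in>W. (1 / card W) *\<^sub>R v)"
    by (simp add: centroid_def scaleR_right.sum[symmetric] inverse_eq_divide)
  then show ?thesis using assms by (auto simp: convex_hull_finite intro!: exI[of _ "\<lambda>_. 1 / card W"])
qed

lemma bcoord_centroid:
  assumes V: "\<not> affine_dependent V" and "W \<subseteq> V" "W \<noteq> {}"
  shows "bcoord V (centroid W) = (\<lambda>v. if v \<in> W then 1 / card W else 0)"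
proof -
  have fin: "finite V" "finite W" 
    using V \<open>W \<subseteq> V\<close> by (auto intro: aff_independent_finite finite_subset)
  have VW: "V \<inter> W = W" using \<open>W \<subseteq> V\<close> by auto
  have 1: "(\<Sum>v\<in>V. (if v \<in> W then 1 / card W else 0) *\<^sub>R v) = centroid W"
    using fin VW by (simp add: centroid_def scaleR_right.sum[symmetric] inverse_eq_divide
      if_distrib[of "\<lambda>c. c *\<^sub>R _"] sum.If_cases Collect_conj_eq[symmetric] cong: if_cong)
  have 2: "(\<Sum>v\<in>V. (if v \<in> W then 1 / card W else 0)) = (1::real)"
    using fin VW \<open>W \<noteq> {}\<close> by (simp add: sum.If_cases)
  show ?thesis using 1 2 \<open>W \<subseteq> V\<close> by (intro bcoord_eqI[OF V]) auto
qed

lemma centroid_in_hull_iff: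
  assumes V: "\<not> affine_dependent V" and "W \<subseteq> V" "W \<noteq> {}" "U \<subseteq> V"
  shows "centroid W \<in> convex hull U \<longleftrightarrow> W \<subseteq> U"
proof -
  have fin: "finite V" "finite W" 
    using V \<open>W \<subseteq> V\<close> by (auto intro: aff_independent_finite finite_subset)
  have "centroid W \<in> convex hull V" 
    using centroid_in_hull[OF fin(2) \<open>W \<noteq> {}\<close>] hull_mono[OF \<open>W \<subseteq> V\<close>] by blast
  moreover have "{v. 0 < bcoord V (centroid W) v} = W"
    using fin \<open>W \<noteq> {}\<close> by (auto simp: bcoord_centroid[OF assms(1-3)] card_gt_0_iff)
  ultimately show ?thesis using mem_hull_subset_iff[OF V \<open>U \<subseteq> V\<close>] by simp
qed

lemma inj_on_centroid:
  assumes V: "\<not> affine_dependent V"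
  shows "inj_on centroid (Pow V - {{}})"
proof (rule inj_onI)
  fix U W assume "U \<in> Pow V - {{}}" "W \<in> Pow V - {{}}" and eq: "centroid U = centroid W"
  then have U: "U \<subseteq> V" "U \<noteq> {}" and W: "W \<subseteq> V" "W \<noteq> {}" by auto
  have "finite V" using V by (rule aff_independent_finite)
  have "centroid U \<in> convex hull U" "centroid W \<in> convex hull W"
    using U W by (auto intro!: centroid_in_hull intro: finite_subset[OF _ \<open>finite V\<close>])
  then show "U = W"
    using centroid_in_hull_iff[OF V W U(1)] centroid_in_hull_iff[OF V U W(1)] eq by auto
qed

lemma finite_chain_has_greatest:
  assumes "finite C" "C \<noteq> {}" "chain_subset C"
  obtains W where "W \<in> C" "\<And>U. U \<in> C \<Longrightarrow> U \<subseteq> W"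
  using finite_has_maximal[OF assms(1,2)] assms(3) unfolding chain_subset_def by metis

lemma finite_chain_has_least:
  assumes "finite C" "C \<noteq> {}" "chain_subset C"
  obtains W where "W \<in> C" "\<And>U. U \<in> C \<Longrightarrow> W \<subseteq> U"
  using finite_has_minimal[OF assms(1,2)] assms(3) unfolding chain_subset_def by metis

text \<open>
  Adding the vertices in the order of the chain, each new centroid has a positive coordinate at a vertex
  of the new set which the previous sets do not contain, so it leaves their affine hull.
\<close>

lemma affine_independent_centroids:
  assumes V: "\<not> affine_dependent V" and "C \<subseteq> Pow V - {{}}" "chain_subset C"
  shows "\<not> affine_dependent (centroid ` C)"
proof -
  have finV: "finite V" using V by (rule aff_independent_finite)
  have "finite C" using \<open>C \<subseteq> _\<close> finV by (meson finite_Diff finite_Pow_iff finite_subset)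
  then show ?thesis using assms(2,3)
  proof (induction "card C" arbitrary: C)
    case 0
    then show ?case by (simp add: affine_dependent_def)
  next
    case (Suc k)
    have "C \<noteq> {}" using Suc.hyps(2) by auto
    then obtain W where W: "W \<in> C" "\<And>U. U \<in> C \<Longrightarrow> U \<subseteq> W"
      using finite_chain_has_greatest Suc.prems by metis
    define C' where "C' = C - {W}"
    have C': "C = insert W C'" "W \<notin> C'" using W by (auto simp: C'_def)
    have fin': "finite C'" using Suc.prems(1) by (simp add: C'_def)
    have ch': "chain_subset C'" using Suc.prems(3) unfolding chain_subset_def C'_def by blast
    have ind: "\<not> affine_dependent (centroid ` C')"
    proof (rule Suc.hyps(1))
      show "k = card C'" "finite C'" using Suc.hyps(2) Suc.prems(1) W(1) by (simp_all add: C'_def)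
      show "C' \<subseteq> Pow V - {{}}" using Suc.prems(2) by (auto simp: C'_def)
      show "chain_subset C'" by (rule ch')
    qed
    have "centroid W \<notin> affine hull (centroid ` C')"
    proof (cases "C' = {}")
      case False
      then obtain W' where W': "W' \<in> C'" "\<And>U. U \<in> C' \<Longrightarrow> U \<subseteq> W'"
        using finite_chain_has_greatest[of C'] fin' ch' by metis
      have "W' \<subset> W" using W' W(2)[of W'] C' by auto
      then obtain a where a: "a \<in> W" "a \<notin> W'" by auto
      have sub: "W' \<subseteq> V" "W \<subseteq> V" "W \<noteq> {}" "\<And>U. U \<in> C' \<Longrightarrow> U \<noteq> {}" using W' W C' Suc.prems by auto
      have "centroid ` C' \<subseteq> convex hull W'"
      proof
        fix y assume "y \<in> centroid ` C'"
        then obtain U where "y = centroid U" "U \<in> C'" by auto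
        moreover have "U \<subseteq> W'" "U \<noteq> {}" using W' sub \<open>U \<in> C'\<close> by auto
        ultimately show "y \<in> convex hull W'"
          using centroid_in_hull[of U] hull_mono[of U W' convex] finV sub(1) finite_subset[of _ V]
          by (metis order_trans subsetD)
      qed
      then have "affine hull (centroid ` C') \<subseteq> affine hull W'"
        by (metis convex_hull_subset_affine_hull hull_minimal hull_hull affine_affine_hull order_trans)
      moreover have "centroid W \<notin> affine hull W'"
      proof
        have finW': "finite W'" using finV sub finite_subset by blast
        assume "centroid W \<in> affine hull W'"
        then obtain u where u: "sum u W' = 1" "(\<Sum>v\<in>W'. u v *\<^sub>R v) = centroid W"
          using affine_hull_finite[OF finW'] by auto
        define w where "w = (\<lambda>v. if v \<in> W' then u v else 0)"
        have VW: "V \<inter> W' = W'" using sub by auto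
        have "sum w V = 1" "(\<Sum>v\<in>V. w v *\<^sub>R v) = centroid W"
          using u finV VW by (auto simp: w_def if_distrib[of "\<lambda>c. c *\<^sub>R _"] sum.If_cases cong: if_cong)
        then have "bcoord V (centroid W) = w"
          using sub by (intro bcoord_eqI[OF V]) (auto simp: w_def)
        then have "bcoord V (centroid W) a = 0" using a by (simp add: w_def)
        moreover have "bcoord V (centroid W) a = 1 / card W"
          using bcoord_centroid[OF V sub(2,3)] a by simp
        moreover have "card W > 0" using finV sub finite_subset card_gt_0_iff by blast
        ultimately show False by simp
      qed
      ultimately show ?thesis by blast
    qed simp
    then show ?case using ind C' by (simp add: affine_independent_insert)
  qed
qed

text \<open>
  The superlevel sets of \<open>u\<close> at its positive values. For the barycentric coordinates of a point these are
  the vertex sets of the simplices whose barycenters span the open simplex of the subdivision which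
  contains the point.
\<close>

definition levels :: "('a \<Rightarrow> real) \<Rightarrow> 'a set set" where
  "levels u = {{v. u w \<le> u v} | w. 0 < u w}"

text \<open>
  Layer-cake decomposition, by induction on the size of the support: subtracting the smallest positive
  value from \<open>u\<close> on its support removes precisely the largest level set.
\<close>

lemma levels_decomposition:
  assumes "finite {v. u v \<noteq> 0}" "\<And>v. 0 \<le> u v"
  shows "\<exists>c. (\<forall>W. 0 \<le> c W) \<and> (\<forall>v. u v = (\<Sum>W\<in>levels u. if v \<in> W then c W else (0::real)))"
  using assms
proof (induction "card {v. u v \<noteq> 0}" arbitrary: u rule: less_induct)
  case (less u)
  define s where "s = {v. u v \<noteq> 0}"
  have fin: "finite s" using less.prems by (simp add: s_def)
  have s_pos: "v \<in> s \<longleftrightarrow> 0 < u v" for v using less.prems(2)[of v] by (auto simp: s_def)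
  show ?case
  proof (cases "s = {}")
    case True
    then have "u v = 0" for v by (auto simp: s_def)
    moreover from this have "levels u = {}" by (auto simp: levels_def)
    ultimately show ?thesis by (intro exI[of _ "\<lambda>_. 0"]) simp
  next
    case False
    \<comment> \<open>peel off the layer of height \<open>m\<close> over the whole support\<close>
    define m where "m = Min (u ` s)"
    have m: "m \<in> u ` s" "\<And>v. v \<in> s \<Longrightarrow> m \<le> u v" using fin False by (auto simp: m_def)
    then obtain a where a: "a \<in> s" "u a = m" by auto
    have "0 < m" using a s_pos by auto
    define u' where "u' = (\<lambda>v. if v \<in> s then u v - m else 0)"
    have u'0: "0 \<le> u' v" for v using m by (auto simp: u'_def)
    have sub: "{v. u' v \<noteq> 0} \<subset> s" using a by (auto simp: u'_def)
    then have "finite {v. u' v \<noteq> 0}" "card {v. u' v \<noteq> 0} < card s"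
      using fin finite_subset psubset_card_mono by blast+
    then obtain c where c: "\<forall>W. 0 \<le> c W" "\<And>v. u' v = (\<Sum>W\<in>levels u'. if v \<in> W then c W else (0::real))"
      using less.hyps[of u'] u'0 unfolding s_def by blast
    have u0: "u v = 0" if "v \<notin> s" for v using that by (simp add: s_def)
    have lev_eq: "{v. u' w \<le> u' v} = {v. u w \<le> u v}" if "w \<in> s" "m < u w" for w
    proof (rule Collect_cong)
      fix v
      show "u' w \<le> u' v \<longleftrightarrow> u w \<le> u v"
        using that u0[of v] \<open>0 < m\<close> by (cases "v \<in> s") (auto simp: u'_def)
    qed
    have lev: "levels u = insert s (levels u')"
    proof (intro equalityI subsetI)
      fix W assume "W \<in> levels u"
      then obtain w where w: "W = {v. u w \<le> u v}" "0 < u w" by (auto simp: levels_def)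
      show "W \<in> insert s (levels u')"
      proof (cases "u w = m")
        case True
        then have "W = s" using w m s_pos \<open>0 < m\<close> by fastforce
        then show ?thesis by simp
      next
        case False
        then have "m < u w" using m(2)[of w] w s_pos by fastforce
        moreover have "w \<in> s" using w s_pos by blast
        ultimately have "W = {v. u' w \<le> u' v}" "0 < u' w" using w lev_eq by (auto simp: u'_def)
        then show ?thesis unfolding levels_def by blast
      qed
    next
      fix W assume "W \<in> insert s (levels u')"
      then show "W \<in> levels u"
      proof
        assume "W = s"
        then have "W = {v. u a \<le> u v}" using m(2) a s_pos \<open>0 < m\<close> by fastforce
        then show ?thesis using a s_pos by (auto simp: levels_def)
      next
        assume "W \<in> levels u'"
        then obtain w where w: "W = {v. u' w \<le> u' v}" "0 < u' w" by (auto simp: levels_def)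
        then have "w \<in> s" "m < u w" by (auto simp: u'_def split: if_splits)
        then have "W = {v. u w \<le> u v}" "0 < u w" using w(1) lev_eq s_pos by blast+
        then show ?thesis unfolding levels_def by blast
      qed
    qed
    have nin: "s \<notin> levels u'" 
    proof
      assume "s \<in> levels u'"
      then obtain w where "s = {v. u' w \<le> u' v}" "0 < u' w" by (auto simp: levels_def)
      then have "u' a > 0" using a by auto
      then show False using a by (simp add: u'_def)
    qed
    have finl: "finite (levels u')"
    proof (rule finite_subset)
      show "levels u' \<subseteq> Pow s" unfolding levels_def u'_def by auto
      show "finite (Pow s)" using fin by simp
    qed
    \<comment> \<open>\<open>s\<close> is a new level set, so its weight may be chosen freely\<close>
    define d where "d = c(s := m)"
    have "u v = (\<Sum>W\<in>levels u. if v \<in> W then d W else 0)" for v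
    proof -
      have "(\<Sum>W\<in>levels u. if v \<in> W then d W else 0) = 
          (if v \<in> s then m else 0) + (\<Sum>W\<in>levels u'. if v \<in> W then d W else 0)"
        using nin finl by (simp add: lev d_def)
      also have "(\<Sum>W\<in>levels u'. if v \<in> W then d W else 0) = (\<Sum>W\<in>levels u'. if v \<in> W then c W else 0)"
        by (rule sum.cong) (use nin in \<open>auto simp: d_def\<close>)
      also have "\<dots> = u' v" by (rule c(2)[symmetric])
      finally show ?thesis by (auto simp: u'_def s_def)
    qed
    moreover have "\<forall>W. 0 \<le> d W" using c \<open>0 < m\<close> by (simp add: d_def)
    ultimately show ?thesis by blast
  qed
qed

text \<open>
  Conversely, a positive combination of indicator functions of a chain has its level sets in the chain: the
  level set of \<open>u\<close> at \<open>w\<close> is the smallest member of the chain that contains \<open>w\<close> and has positive weight.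
\<close>

lemma levels_of_chain_sum:
  assumes "finite C" "chain_subset C" and c: "\<And>W. W \<in> C \<Longrightarrow> 0 \<le> c W"
    and u: "\<And>v. u v = (\<Sum>W\<in>C. if v \<in> W then c W else (0::real))"
  shows "levels u \<subseteq> C"
proof
  fix U assume "U \<in> levels u"
  then obtain w where U: "U = {v. u w \<le> u v}" "0 < u w" by (auto simp: levels_def)
  define P where "P = {W\<in>C. w \<in> W \<and> 0 < c W}"
  have "P \<noteq> {}"
  proof
    assume "P = {}"
    then have "u w \<le> 0" unfolding u P_def using c by (intro sum_nonpos) force
    then show False using U by simp
  qed
  moreover have "finite P" "chain_subset P" using assms(1,2) by (auto simp: P_def chain_subset_def)
  ultimately obtain W where W: "W \<in> P" "\<And>W'. W' \<in> P \<Longrightarrow> W \<subseteq> W'"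
    using finite_chain_has_least by metis
  have WC: "W \<in> C" "w \<in> W" "0 < c W" using W by (auto simp: P_def)
  have "U = W"
  proof (intro equalityI subsetI)
    fix v assume "v \<in> W"
    then have "v \<in> W'" if "W' \<in> C" "w \<in> W'" "0 < c W'" for W' using W(2)[of W'] that by (auto simp: P_def)
    then have "u w \<le> u v" unfolding u
      by (intro sum_mono) (use c in force)
    then show "v \<in> U" using U by simp
  next
    fix v assume "v \<in> U"
    show "v \<in> W"
    proof (rule ccontr)
      assume "v \<notin> W"
      have imp: "w \<in> W'" if "W' \<in> C" "v \<in> W'" for W'
        using that \<open>v \<notin> W\<close> WC assms(2) unfolding chain_subset_def by blast
      have "u v < u w" unfolding u
      proof (rule sum_strict_mono_ex1)
        show "\<forall>W'\<in>C. (if v \<in> W' then c W' else 0) \<le> (if w \<in> W' then c W' else 0)"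
          using imp c by auto
        show "\<exists>W'\<in>C. (if v \<in> W' then c W' else 0) < (if w \<in> W' then c W' else 0)"
          using WC \<open>v \<notin> W\<close> by auto
      qed fact
      then show False using \<open>v \<in> U\<close> U by simp
    qed
  qed
  then show "U \<in> C" using WC by simp
qed

text \<open>
  The faces of the barycentric subdivision are recognised from the level sets of the coordinates. This
  reduces all geometry of the subdivision to the combinatorics of level sets; in particular
  intersections of simplices become intersections of chains.
\<close>

lemma hull_centroids_iff:
  assumes V: "\<not> affine_dependent V" and C: "C \<subseteq> Pow V - {{}}" "chain_subset C"
  shows "x \<in> convex hull (centroid ` C) \<longleftrightarrow> x \<in> convex hull V \<and> levels (bcoord V x) \<subseteq> C"
proof -
  have finV: "finite V" using V by (rule aff_independent_finite)
  have finC: "finite C" using C finV by (meson finite_Diff finite_Pow_iff finite_subset)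
  have finW: "finite W" "W \<noteq> {}" "W \<subseteq> V" "card W > 0" if "W \<in> C" for W
  proof -
    show "W \<noteq> {}" "W \<subseteq> V" using that C by auto
    then show "finite W" using finV finite_subset by blast
    then show "card W > 0" using \<open>W \<noteq> {}\<close> by (simp add: card_gt_0_iff)
  qed
  have card0: "card W \<noteq> 0" if "W \<in> C" for W using finW(4)[OF that] by simp
  have swap: "(\<Sum>v\<in>V. (\<Sum>W\<in>C. if v \<in> W then c W else 0) *\<^sub>R f v) = (\<Sum>W\<in>C. c W *\<^sub>R (\<Sum>v\<in>W. f v))"
    for c :: "'a set \<Rightarrow> real" and f :: "'a \<Rightarrow> 'b::real_vector"
  proof -
    have "(\<Sum>v\<in>V. (\<Sum>W\<in>C. if v \<in> W then c W else 0) *\<^sub>R f v)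
        = (\<Sum>v\<in>V. \<Sum>W\<in>C. if v \<in> W then c W *\<^sub>R f v else 0)"
      by (auto simp: scaleR_left.sum intro!: sum.cong)
    also have "\<dots> = (\<Sum>W\<in>C. \<Sum>v\<in>V. if v \<in> W then c W *\<^sub>R f v else 0)" by (rule sum.swap)
    also have "\<dots> = (\<Sum>W\<in>C. c W *\<^sub>R (\<Sum>v\<in>W. f v))"
    proof (rule sum.cong)
      fix W assume "W \<in> C"
      then have "V \<inter> W = W" using finW by auto
      then show "(\<Sum>v\<in>V. if v \<in> W then c W *\<^sub>R f v else 0) = c W *\<^sub>R (\<Sum>v\<in>W. f v)"
        using finV by (simp add: sum.If_cases scaleR_right.sum)
    qed simp
    finally show ?thesis .
  qed
  show ?thesis
  proof
    assume x: "x \<in> convex hull (centroid ` C)"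
    have "inj_on centroid C" using inj_on_centroid[OF V] C inj_on_subset by blast
    obtain b where b: "\<forall>y\<in>centroid ` C. 0 \<le> b y" "sum b (centroid ` C) = 1" "(\<Sum>y\<in>centroid ` C. b y *\<^sub>R y) = x"
      using x finC by (auto simp: convex_hull_finite)
    define c where "c = (\<lambda>W. b (centroid W) / card W)"
    define u where "u = (\<lambda>v. \<Sum>W\<in>C. if v \<in> W then c W else 0)"
    have c0: "0 \<le> c W" if "W \<in> C" for W using that b by (auto simp: c_def)
    have bs: "(\<Sum>W\<in>C. b (centroid W)) = 1" "(\<Sum>W\<in>C. b (centroid W) *\<^sub>R centroid W) = x"
      using b \<open>inj_on centroid C\<close> by (auto simp: sum.reindex)
    have "(\<Sum>v\<in>V. u v *\<^sub>R v) = x"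
      unfolding u_def swap bs(2)[symmetric]
      by (rule sum.cong) (auto simp: c_def centroid_def divide_inverse)
    moreover have "sum u V = 1"
    proof -
      have "sum u V = (\<Sum>v\<in>V. u v *\<^sub>R (1::real))" by simp
      also have "\<dots> = (\<Sum>W\<in>C. b (centroid W))" unfolding u_def swap
        by (rule sum.cong) (simp_all add: c_def card0)
      also have "\<dots> = 1" by (rule bs)
      finally show ?thesis .
    qed
    moreover have "u v = 0" if "v \<notin> V" for v
      unfolding u_def using finW that by (intro sum.neutral) auto
    moreover have "0 \<le> u v" for v unfolding u_def using c0 by (intro sum_nonneg) auto
    moreover have "levels u \<subseteq> C" using levels_of_chain_sum[OF finC C(2), of c u] c0 u_def by simp
    ultimately show "x \<in> convex hull V \<and> levels (bcoord V x) \<subseteq> C"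
      using bcoord_eqI[OF V, of u x] finV by (auto simp: convex_hull_finite)
  next
    assume "x \<in> convex hull V \<and> levels (bcoord V x) \<subseteq> C"
    then have x: "x \<in> convex hull V" and lev: "levels (bcoord V x) \<subseteq> C" by auto
    define u where "u = bcoord V x"
    note u = bcoord_convex_hull[OF V x, folded u_def]
    have "{v. u v \<noteq> 0} \<subseteq> V" using u(2) by auto
    then obtain c where c: "\<forall>W. 0 \<le> c W" "\<And>v. u v = (\<Sum>W\<in>levels u. if v \<in> W then c W else (0::real))"
      using levels_decomposition[of u] u(1) finV finite_subset by metis
    define d where "d = (\<lambda>W. if W \<in> levels u then c W else 0)"
    have d0: "0 \<le> d W" for W using c by (simp add: d_def)
    have ud: "u v = (\<Sum>W\<in>C. if v \<in> W then d W else 0)" for v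
    proof -
      have "u v = (\<Sum>W\<in>levels u. if v \<in> W then c W else 0)" by (rule c(2))
      also have "\<dots> = (\<Sum>W\<in>C. if v \<in> W then d W else 0)"
        by (rule sum.mono_neutral_cong_left) (use finC lev in \<open>auto simp: d_def u_def\<close>)
      finally show ?thesis .
    qed
    have "(\<Sum>v\<in>V. u v *\<^sub>R v) = (\<Sum>W\<in>C. d W *\<^sub>R (\<Sum>v\<in>W. v))"
      unfolding ud swap ..
    then have "x = (\<Sum>W\<in>C. (d W * card W) *\<^sub>R centroid W)"
      unfolding u(4) by (auto simp: centroid_def finW intro!: sum.cong dest: finW(4))
    moreover have "(\<Sum>W\<in>C. d W * card W) = 1"
    proof -
      have "1 = (\<Sum>v\<in>V. u v *\<^sub>R (1::real))" using u by simp
      also have "\<dots> = (\<Sum>W\<in>C. d W * card W)" unfolding ud swap by simp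
      finally show ?thesis by simp
    qed
    moreover have "(\<Sum>W\<in>C. (d W * card W) *\<^sub>R centroid W) \<in> convex hull (centroid ` C)"
      if "(\<Sum>W\<in>C. d W * card W) = 1"
      by (rule convex_sum[OF finC convex_convex_hull that]) (use d0 in \<open>auto intro: hull_inc\<close>)
    ultimately show "x \<in> convex hull (centroid ` C)" by simp
  qed
qed

section \<open>Morse tiles in terms of vertex sets\<close>

lemma hull_subset_iff:
  fixes V :: "'a::euclidean_space set"
  assumes V: "\<not> affine_dependent V" and "U \<subseteq> V" "W \<subseteq> V"
  shows "convex hull U \<subseteq> convex hull W \<longleftrightarrow> U \<subseteq> W"
proof
  assume sub: "convex hull U \<subseteq> convex hull W"
  have "finite U" using aff_independent_finite[OF V] \<open>U \<subseteq> V\<close> by (rule rev_finite_subset)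
  show "U \<subseteq> W"
  proof (cases "U = {}")
    case False
    then have "centroid U \<in> convex hull W" using centroid_in_hull[OF \<open>finite U\<close> False] sub by auto
    then show ?thesis using centroid_in_hull_iff[OF V \<open>U \<subseteq> V\<close> False \<open>W \<subseteq> V\<close>] by simp
  qed simp
qed (rule hull_mono)

text \<open>
  Here \<open>R\<close> consists of the vertices opposite to the removed facets and \<open>M\<close> of the vertices of the Morse face.
\<close>

definition tile :: "'a::euclidean_space set \<Rightarrow> 'a set \<Rightarrow> 'a set \<Rightarrow> 'a set" where
  "tile V R M = convex hull V - ((\<Union>v\<in>R. convex hull (V - {v})) \<union> convex hull M)"

text \<open>
  The Morse face avoids being contained in a removed facet exactly when \<open>R \<subseteq> M\<close>, and has codimension at
  least two exactly when \<open>card M < n\<close>.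
\<close>

definition tile_data :: "nat \<Rightarrow> 'a::euclidean_space set \<Rightarrow> 'a set \<Rightarrow> 'a set \<Rightarrow> bool" where
  "tile_data n V R M \<longleftrightarrow> \<not> affine_dependent V \<and> card V = n + 1 \<and> R \<subseteq> V \<and> M \<subseteq> V \<and>
     (M \<noteq> {} \<longrightarrow> R \<noteq> {} \<and> R \<subseteq> M \<and> card M < n)"

lemma mem_tile_iff:
  fixes V :: "'a::euclidean_space set"
  assumes V: "\<not> affine_dependent V" and "R \<subseteq> V" "M \<subseteq> V"
  shows "x \<in> tile V R M \<longleftrightarrow> x \<in> convex hull V \<and> (\<forall>v\<in>R. 0 < bcoord V x v) \<and> (\<exists>v. v \<notin> M \<and> 0 < bcoord V x v)"
proof (cases "x \<in> convex hull V")
  case True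
  have "x \<in> convex hull (V - {v}) \<longleftrightarrow> \<not> 0 < bcoord V x v" if "v \<in> R" for v
    using mem_hull_subset_iff[OF V _ True, of "V - {v}"] bcoord_convex_hull(2)[OF V True] by force
  moreover have "x \<in> convex hull M \<longleftrightarrow> \<not> (\<exists>v. v \<notin> M \<and> 0 < bcoord V x v)"
    using mem_hull_subset_iff[OF V \<open>M \<subseteq> V\<close> True] by auto
  ultimately show ?thesis using True by (auto simp: tile_def)
qed (simp add: tile_def)

text \<open>
  For a point, the facet opposite to the only vertex is the empty set, in accordance with the definition of
  \<^const>\<open>simplex_facets\<close>.
\<close>

lemma simplex_facets_hull:
  fixes V :: "'a::euclidean_space set"
  assumes V: "\<not> affine_dependent V" "V \<noteq> {}"
  shows "simplex_facets (convex hull V) = (\<lambda>v. convex hull (V - {v})) ` V"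
proof -
  have fin: "finite V" using V(1) by (rule aff_independent_finite)
  have dim: "aff_dim (convex hull W) = int (card W) - 1" if "W \<subseteq> V" for W
  proof -
    have "\<not> affine_dependent W" using that V(1) affine_dependent_subset by blast
    then show ?thesis using aff_dim_affine_independent[of W] by (simp add: aff_dim_convex_hull)
  qed
  show ?thesis
  proof (intro equalityI subsetI)
    fix F assume "F \<in> simplex_facets (convex hull V)"
    then have F: "F face_of convex hull V" "aff_dim F = aff_dim (convex hull V) - 1"
      by (auto simp: simplex_facets_def)
    then obtain W where W: "W \<subseteq> V" "F = convex hull W"
      using face_of_convex_hull_affine_independent[OF V(1)] by auto
    then have "card W + 1 = card V" using F dim[of W] dim[of V] by simp
    then have "card (V - W) = 1" using W(1) fin by (simp add: card_Diff_subset finite_subset)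
    then obtain v where "V - W = {v}" by (meson card_1_singletonE)
    then have "v \<in> V" "W = V - {v}" using W(1) by auto
    then show "F \<in> (\<lambda>v. convex hull (V - {v})) ` V" using W by blast
  next
    fix F assume "F \<in> (\<lambda>v. convex hull (V - {v})) ` V"
    then obtain v where v: "v \<in> V" "F = convex hull (V - {v})" by auto
    then have "F face_of convex hull V" using face_of_convex_hull_affine_independent[OF V(1)] by blast
    moreover have "aff_dim F = aff_dim (convex hull V) - 1"
      using v fin dim[of V] dim[of "V - {v}"] card_gt_0_iff[of V] by (auto simp: of_nat_diff)
    ultimately show "F \<in> simplex_facets (convex hull V)" by (simp add: simplex_facets_def)
  qed
qed

lemma inj_on_opposite_facet:
  fixes V :: "'a::euclidean_space set"
  assumes V: "\<not> affine_dependent V"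
  shows "inj_on (\<lambda>v. convex hull (V - {v})) V"
proof (rule inj_onI)
  fix v w assume "v \<in> V" "w \<in> V" "convex hull (V - {v}) = convex hull (V - {w})"
  then have "V - {v} \<subseteq> V - {w}" using hull_subset_iff[OF V, of "V - {v}" "V - {w}"] by auto
  then show "v = w" using \<open>w \<in> V\<close> by auto
qed

text \<open>
  The facets of a simplex are indexed by the opposite vertices and its faces by the subsets of the vertex set.
\<close>

lemma morse_tile_of_iff:
  "morse_tile_of n k \<sigma> \<mu> t \<longleftrightarrow>
     (\<exists>V R M. tile_data n V R M \<and> card R = k \<and> \<sigma> = convex hull V \<and> \<mu> = convex hull M \<and> t = tile V R M)"
proof
  assume L: "morse_tile_of n k \<sigma> \<mu> t"
  then have "int n simplex \<sigma>" by (simp add: morse_tile_of_def)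
  then obtain V where V: "\<not> affine_dependent V" "card V = n + 1" "\<sigma> = convex hull V"
    unfolding simplex_def by (metis of_nat_1 of_nat_add of_nat_eq_iff)
  then have "V \<noteq> {}" by auto
  obtain \<F> where F: "\<F> \<subseteq> simplex_facets \<sigma>" "card \<F> = k" "\<mu> face_of \<sigma>"
    "\<mu> \<noteq> {} \<longrightarrow> 1 \<le> k \<and> aff_dim \<mu> \<le> int n - 2 \<and> (\<forall>F\<in>\<F>. \<not> \<mu> \<subseteq> F)" "t = \<sigma> - (\<Union>\<F> \<union> \<mu>)"
    using L by (auto simp: morse_tile_of_def)
  obtain R where R: "R \<subseteq> V" "\<F> = (\<lambda>v. convex hull (V - {v})) ` R"
    using F(1) V simplex_facets_hull[OF V(1) \<open>V \<noteq> {}\<close>] by (auto simp: subset_image_iff)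
  obtain M where M: "M \<subseteq> V" "\<mu> = convex hull M"
    using F(3) V face_of_convex_hull_affine_independent[OF V(1)] by auto
  have k: "card R = k"
    using F(2) R inj_on_opposite_facet[OF V(1)] by (auto simp: card_image inj_on_subset)
  have "R \<noteq> {}" "R \<subseteq> M" "card M < n" if "M \<noteq> {}"
  proof -
    have F4: "1 \<le> k" "aff_dim \<mu> \<le> int n - 2" "\<And>F. F \<in> \<F> \<Longrightarrow> \<not> \<mu> \<subseteq> F"
      using F(4) that M by auto
    show "R \<noteq> {}" using F4 k by auto
    show "R \<subseteq> M"
    proof
      fix v assume "v \<in> R"
      then have "\<not> convex hull M \<subseteq> convex hull (V - {v})" using F4(3) R M by auto
      then have "\<not> M \<subseteq> V - {v}" using hull_mono by blast
      then show "v \<in> M" using M by auto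
    qed
    have "\<not> affine_dependent M" using V(1) M(1) affine_dependent_subset by blast
    then have "int (card M) = aff_dim \<mu> + 1" using M aff_dim_affine_independent by (simp add: aff_dim_convex_hull)
    then show "card M < n" using F4(2) by linarith
  qed
  then have "tile_data n V R M" using V R M by (auto simp: tile_data_def)
  moreover have "t = tile V R M" using F(5) R M V by (auto simp: tile_def)
  ultimately show "\<exists>V R M. tile_data n V R M \<and> card R = k \<and> \<sigma> = convex hull V \<and> \<mu> = convex hull M \<and> t = tile V R M"
    using k V M by blast
next
  assume "\<exists>V R M. tile_data n V R M \<and> card R = k \<and> \<sigma> = convex hull V \<and> \<mu> = convex hull M \<and> t = tile V R M"
  then obtain V R M where d: "tile_data n V R M" "card R = k" "\<sigma> = convex hull V" "\<mu> = convex hull M" "t = tile V R M"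
    by blast
  then have V: "\<not> affine_dependent V" "card V = n + 1" "R \<subseteq> V" "M \<subseteq> V" "V \<noteq> {}" by (auto simp: tile_data_def)
  define \<F> where "\<F> = (\<lambda>v. convex hull (V - {v})) ` R"
  have "\<F> \<subseteq> simplex_facets \<sigma>" using simplex_facets_hull[OF V(1,5)] V(3) d by (auto simp: \<F>_def)
  moreover have "card \<F> = k" using d V inj_on_opposite_facet[OF V(1)] by (auto simp: card_image inj_on_subset \<F>_def)
  moreover have "\<mu> face_of \<sigma>" using d V face_of_convex_hull_affine_independent[OF V(1)] by auto
  moreover have "1 \<le> k \<and> aff_dim \<mu> \<le> int n - 2 \<and> (\<forall>F\<in>\<F>. \<not> \<mu> \<subseteq> F)" if "\<mu> \<noteq> {}"
  proof (intro conjI ballI)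
    have M: "R \<noteq> {}" "R \<subseteq> M" "card M < n" using d that by (auto simp: tile_data_def)
    have "finite R" using V aff_independent_finite finite_subset by blast
    then show "1 \<le> k" using d(2) M(1) card_gt_0_iff[of R] by simp
    have "\<not> affine_dependent M" using V(1,4) affine_dependent_subset by blast
    then have "int (card M) = aff_dim \<mu> + 1" using d aff_dim_affine_independent by (simp add: aff_dim_convex_hull)
    then show "aff_dim \<mu> \<le> int n - 2" using M by linarith
    fix F assume "F \<in> \<F>"
    then obtain v where "v \<in> R" "F = convex hull (V - {v})" by (auto simp: \<F>_def)
    then show "\<not> \<mu> \<subseteq> F" using d M hull_subset_iff[OF V(1) V(4), of "V - {v}"] by auto
  qed
  moreover have "t = \<sigma> - (\<Union>\<F> \<union> \<mu>)" using d by (simp add: tile_def \<F>_def)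
  moreover have "int n simplex \<sigma>" using V d by (auto simp: simplex_def)
  ultimately show "morse_tile_of n k \<sigma> \<mu> t" unfolding morse_tile_of_def by blast
qed

lemma rel_interior_subset_tile:
  assumes d: "tile_data n V R M"
  shows "rel_interior (convex hull V) \<subseteq> tile V R M"
proof -
  have V: "\<not> affine_dependent V" "card V = n + 1" "R \<subseteq> V" "M \<subseteq> V" using d by (auto simp: tile_data_def)
  have fin: "finite V" using V(1) by (rule aff_independent_finite)
  have "convex hull W \<inter> rel_interior (convex hull V) = {}" if "W \<subset> V" for W
  proof (rule face_of_disjoint_rel_interior)
    show "convex hull W face_of convex hull V"
      using face_of_convex_hull_affine_independent[OF V(1)] that by blast
    show "convex hull W \<noteq> convex hull V" using hull_subset_iff[OF V(1), of V W] that by auto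
  qed
  moreover have "V - {v} \<subset> V" if "v \<in> R" for v using that V by auto
  moreover have "M \<subset> V" using d fin by (cases "M = {}") (auto simp: tile_data_def)
  moreover have "rel_interior (convex hull V) \<subseteq> convex hull V" by (rule rel_interior_subset)
  ultimately show ?thesis unfolding tile_def by blast
qed

text \<open>
  The open simplex is contained in the tile, because the removed faces are proper.
\<close>

lemma closure_tile:
  assumes d: "tile_data n V R M"
  shows "closure (tile V R M) = convex hull V"
proof
  have "finite V" using d by (auto simp: tile_data_def intro: aff_independent_finite)
  then have cl: "closed (convex hull V)" by (simp add: compact_imp_closed finite_imp_compact_convex_hull)
  then show "closure (tile V R M) \<subseteq> convex hull V" by (intro closure_minimal) (auto simp: tile_def)
  have "convex hull V = closure (rel_interior (convex hull V))"
    using cl by (simp add: convex_closure_rel_interior)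
  also have "\<dots> \<subseteq> closure (tile V R M)" by (intro closure_mono rel_interior_subset_tile[OF d])
  finally show "convex hull V \<subseteq> closure (tile V R M)" .
qed

lemma tile_nonempty:
  assumes d: "tile_data n V R M"
  shows "tile V R M \<noteq> {}"
proof
  assume "tile V R M = {}"
  then have "convex hull V = {}" using closure_tile[OF d] by simp
  then show False using d by (auto simp: tile_data_def convex_hull_eq_empty)
qed

text \<open>
  Centroids of faces are test points which detect whether an open face of the simplex belongs to the tile.
\<close>

lemma not_mem_tile_centroid_iff:
  assumes d: "tile_data n V R M" and W: "W \<subseteq> V" "W \<noteq> {}"
  shows "centroid W \<notin> tile V R M \<longleftrightarrow> \<not> R \<subseteq> W \<or> W \<subseteq> M"
proof -
  have V: "\<not> affine_dependent V" "R \<subseteq> V" "M \<subseteq> V" using d by (auto simp: tile_data_def)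
  have "centroid W \<in> convex hull V" using centroid_in_hull_iff[OF V(1) W, of V] W by simp
  moreover have "centroid W \<in> convex hull (V - {v}) \<longleftrightarrow> v \<notin> W" for v
    using centroid_in_hull_iff[OF V(1) W, of "V - {v}"] W by auto
  moreover have "centroid W \<in> convex hull M \<longleftrightarrow> W \<subseteq> M" using centroid_in_hull_iff[OF V(1) W V(3)] .
  ultimately show ?thesis by (auto simp: tile_def)
qed

lemma tile_eq_imp_face_subset:
  assumes d: "tile_data n V R M" "tile_data n V R' M'" and eq: "tile V R M = tile V R' M'"
  shows "M \<subseteq> M'" "n \<noteq> 0 \<Longrightarrow> R \<subseteq> R'"
proof -
  have sub: "R \<subseteq> V" "M \<subseteq> V" "R' \<subseteq> V" "M' \<subseteq> V" "card V = n + 1" using d by (auto simp: tile_data_def)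
  have fin: "finite V" using d by (auto simp: tile_data_def intro: aff_independent_finite)
  have RR: "R \<subseteq> R'" if "n \<noteq> 0" and d: "tile_data n V R M" "tile_data n V R' M'" and eq: "tile V R M = tile V R' M'" for R R' M M'
  proof
    have sub: "R \<subseteq> V" "M \<subseteq> V" "R' \<subseteq> V" "M' \<subseteq> V" "card V = n + 1" using d by (auto simp: tile_data_def)
    fix v assume "v \<in> R"
    have c: "card (V - {v}) = n" using sub \<open>v \<in> R\<close> fin by auto
    then have ne: "V - {v} \<noteq> {}" using \<open>n \<noteq> 0\<close> by (metis card.empty)
    \<comment> \<open>the open facet opposite to \<open>v\<close> is missing, and it is too large to lie in a Morse face\<close>
    have "centroid (V - {v}) \<notin> tile V R' M'"
      using not_mem_tile_centroid_iff[OF d(1) _ ne] \<open>v \<in> R\<close> eq by auto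
    then have "\<not> R' \<subseteq> V - {v} \<or> V - {v} \<subseteq> M'" using not_mem_tile_centroid_iff[OF d(2) _ ne] by auto
    moreover have "\<not> V - {v} \<subseteq> M'"
    proof
      assume *: "V - {v} \<subseteq> M'"
      then have "M' \<noteq> {}" using ne by auto
      then have "card M' < n" using d(2) by (simp add: tile_data_def)
      moreover have "card (V - {v}) \<le> card M'" using * sub fin by (meson card_mono finite_subset)
      ultimately show False using c by simp
    qed
    ultimately show "v \<in> R'" using sub by auto
  qed
  show "R \<subseteq> R'" if "n \<noteq> 0" using RR[OF that d eq] .
  show "M \<subseteq> M'"
  proof (cases "M = {}")
    case False
    then have "n \<noteq> 0" "R \<subseteq> M" using d(1) by (auto simp: tile_data_def)
    have "centroid M \<notin> tile V R' M'" using not_mem_tile_centroid_iff[OF d(1) sub(2) False] eq by simp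
    then have "\<not> R' \<subseteq> M \<or> M \<subseteq> M'" using not_mem_tile_centroid_iff[OF d(2) sub(2) False] by simp
    moreover have "R' \<subseteq> R" using RR[OF \<open>n \<noteq> 0\<close> d(2,1)] eq by simp
    ultimately show ?thesis using \<open>R \<subseteq> M\<close> by blast
  qed simp
qed

text \<open>
  A tile determines its simplex as its closure, and then its removed faces by testing centroids. In
  dimension \<open>0\<close> the removed facet is empty and leaves no trace, whence the condition on \<open>n\<close>.
\<close>

lemma tile_eq_iff_data:
  assumes d: "tile_data n V R M" "tile_data n' V' R' M'" and eq: "tile V R M = tile V' R' M'"
  shows "n = n'" "V = V'" "M = M'" "n \<noteq> 0 \<Longrightarrow> R = R'"
proof -
  have "convex hull V = convex hull V'" using closure_tile[OF d(1)] closure_tile[OF d(2)] eq by simp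
  then show V: "V = V'"
    using extreme_point_of_convex_hull_affine_independent[of V] extreme_point_of_convex_hull_affine_independent[of V'] d
    by (auto simp: tile_data_def)
  then show n: "n = n'" using d by (simp add: tile_data_def)
  note d' = d(2)[folded n V]
  note eq' = eq[folded V]
  show "M = M'" "n \<noteq> 0 \<Longrightarrow> R = R'"
    using tile_eq_imp_face_subset[OF d(1) d' eq'] tile_eq_imp_face_subset[OF d' d(1) eq'[symmetric]] by auto
qed

text \<open>
  Criticality as a condition on the dimension \<open>n\<close>, the order \<open>k\<close> and the number \<open>m\<close> of vertices of the
  Morse face; its dimension is \<open>m - 1\<close>.
\<close>

definition critical_data :: "nat \<Rightarrow> nat \<Rightarrow> nat \<Rightarrow> nat \<Rightarrow> bool" where
  "critical_data n k m i \<longleftrightarrow>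
     k = 0 \<and> i = 0 \<or> k = n + 1 \<and> i = n \<or> 1 \<le> k \<and> k < n \<and> m = k \<and> i = k"

text \<open>
  The tile determines its data except for the order of a point, which may be \<open>0\<close> or \<open>1\<close>; both values make
  the point critical of index \<open>0\<close>.
\<close>

lemma critical_tile_iff:
  assumes d: "tile_data n V R M"
  shows "critical_tile (tile V R M) i \<longleftrightarrow> critical_data n (card R) (card M) i"
proof -
  have aff: "aff_dim (convex hull M') = int k - 1 \<longleftrightarrow> card M' = k" if "tile_data n' V' R' M'" for n' V' R' M' k
  proof -
    have "\<not> affine_dependent M'" using that affine_dependent_subset by (auto simp: tile_data_def)
    then show ?thesis using aff_dim_affine_independent[of M'] by (auto simp: aff_dim_convex_hull)
  qed
  have crit: "critical_tile t i \<longleftrightarrow> (\<exists>n V R M. tile_data n V R M \<and> t = tile V R M \<and> critical_data n (card R) (card M) i)" for t :: "'a set"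
  proof
    assume "critical_tile t i"
    then obtain n V R M where d: "tile_data n V R M" "t = tile V R M"
      and c: "card R = 0 \<and> i = 0 \<or> card R = n + 1 \<and> i = n \<or>
        1 \<le> card R \<and> card R < n \<and> aff_dim (convex hull M) = int (card R) - 1 \<and> i = card R"
      unfolding critical_tile_def morse_tile_of_iff by blast
    from c have "critical_data n (card R) (card M) i"
      unfolding aff[OF d(1)] critical_data_def by blast
    then show "\<exists>n V R M. tile_data n V R M \<and> t = tile V R M \<and> critical_data n (card R) (card M) i"
      using d by blast
  next
    assume "\<exists>n V R M. tile_data n V R M \<and> t = tile V R M \<and> critical_data n (card R) (card M) i"
    then obtain n V R M where d: "tile_data n V R M" "t = tile V R M"
      and c: "critical_data n (card R) (card M) i" by blast
    have "morse_tile_of n (card R) (convex hull V) (convex hull M) t"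
      using d unfolding morse_tile_of_iff by blast
    then show "critical_tile t i"
      using c unfolding critical_tile_def critical_data_def aff[OF d(1), symmetric] by blast
  qed
  show ?thesis unfolding crit
  proof
    assume "\<exists>n' V' R' M'. tile_data n' V' R' M' \<and> tile V R M = tile V' R' M' \<and> critical_data n' (card R') (card M') i"
    then obtain n' V' R' M' where d': "tile_data n' V' R' M'" and "tile V R M = tile V' R' M'" 
      and c: "critical_data n' (card R') (card M') i" by blast
    then have eq: "n = n'" "V = V'" "M = M'" "n \<noteq> 0 \<Longrightarrow> R = R'" using tile_eq_iff_data[OF d] by auto
    have "card R \<le> 1" if "n = 0"
      using d that card_mono[of V R] aff_independent_finite by (auto simp: tile_data_def)
    then show "critical_data n (card R) (card M) i" using eq c by (cases "n = 0") (auto simp: critical_data_def)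
  qed (use d in blast)
qed

lemma morse_tile_of_tile:
  assumes "tile_data n V R M"
  shows "morse_tile_of n' k \<sigma> \<mu> (tile V R M) \<Longrightarrow> n' = n \<and> \<sigma> = convex hull V \<and> \<mu> = convex hull M"
    and "morse_tile_of n (card R) (convex hull V) (convex hull M) (tile V R M)"
  using assms tile_eq_iff_data[OF assms] unfolding morse_tile_of_iff by blast+

section \<open>Orderings of the vertices of a simplex\<close>

lemma sorted_wrt_unique:
  assumes asym: "\<And>v w. P v w \<Longrightarrow> \<not> P w v"
    and "sorted_wrt P p" "sorted_wrt P q" "set p = set q"
  shows "p = q"
  using assms(2-)
proof (induction p arbitrary: q)
  case (Cons x p)
  then obtain y q' where q: "q = y # q'" by (cases q) auto
  have irrefl: "\<not> P v v" for v using asym by blast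
  have "x = y"
  proof (rule ccontr)
    assume "x \<noteq> y"
    then have "x \<in> set q'" "y \<in> set p" using Cons.prems(3) q by auto
    then have "P y x" "P x y" using Cons.prems q by auto
    then show False using asym by blast
  qed
  moreover have "x \<notin> set p" "y \<notin> set q'" using Cons.prems q irrefl by auto
  ultimately have "set p = set q'" using Cons.prems(3) q by auto
  then have "p = q'" using Cons q by auto
  then show ?case using \<open>x = y\<close> q by simp
qed simp

lemma ex_sorted_wrt:
  assumes "finite V" "transp P" and irrefl: "\<And>v. \<not> P v v"
    and "\<And>v w. v \<in> V \<Longrightarrow> w \<in> V \<Longrightarrow> v \<noteq> w \<Longrightarrow> P v w \<or> P w v"
  shows "\<exists>p. distinct p \<and> set p = V \<and> sorted_wrt P p"
  using assms(1,4)
proof (induction V)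
  case (insert x V)
  then obtain p where p: "distinct p" "set p = V" "sorted_wrt P p" by auto
  define q where "q = filter (\<lambda>v. P v x) p @ x # filter (P x) p"
  have "P v w" if "P v x" "P x w" for v w using that \<open>transp P\<close> by (meson transpD)
  then have "sorted_wrt P q" using p by (auto simp: q_def sorted_wrt_append sorted_wrt_filter)
  moreover have "set q = insert x V"
    using insert.prems[of _ x] insert.hyps p by (auto simp: q_def)
  moreover have "distinct q"
  proof -
    have "\<not> (P v x \<and> P x v)" for v using irrefl \<open>transp P\<close> by (meson transpD)
    then show ?thesis using p irrefl by (auto simp: q_def)
  qed
  ultimately show ?case by blast
qed simp

lemma ex1_sorted_permutation:
  assumes "finite V" "transp P" "\<And>v. \<not> P v v"
    and "\<And>v w. v \<in> V \<Longrightarrow> w \<in> V \<Longrightarrow> v \<noteq> w \<Longrightarrow> P v w \<or> P w v"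
  shows "\<exists>!p. p \<in> permutations_of_set V \<and> sorted_wrt P p"
proof -
  have asym: "\<not> P w v" if "P v w" for v w using that assms(2,3) by (meson transpD)
  obtain p where p: "distinct p" "set p = V" "sorted_wrt P p"
    using ex_sorted_wrt[of V P] assms by blast
  show ?thesis
  proof (rule ex1I)
    show "p \<in> permutations_of_set V \<and> sorted_wrt P p" using p by (simp add: permutations_of_setI)
    show "q = p" if "q \<in> permutations_of_set V \<and> sorted_wrt P q" for q
      using sorted_wrt_unique[of P q p] asym that p by (auto dest: permutations_of_setD)
  qed
qed

text \<open>
  The vertex set whose centroid is the \<open>i\<close>-th vertex of the simplex of the subdivision given by \<open>p\<close>. The last
  node, with index \<open>length p - 1\<close>, is the whole set.
\<close>

definition node :: "'a list \<Rightarrow> nat \<Rightarrow> 'a set" where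
  "node p i = set (take (Suc i) p)"

lemma mem_node_iff: "v \<in> node p i \<longleftrightarrow> (\<exists>j\<le>i. j < length p \<and> v = p ! j)"
  by (auto simp: node_def in_set_conv_nth less_Suc_eq_le) 

lemma nth_mem_node_iff:
  assumes "distinct p" "j < length p"
  shows "p ! j \<in> node p i \<longleftrightarrow> j \<le> i"
  using assms by (auto simp: mem_node_iff nth_eq_iff_index_eq)

lemma node_mono: "i \<le> j \<Longrightarrow> node p i \<subseteq> node p j"
  unfolding node_def by (rule set_take_subset_set_take) simp

lemma node_psubset_iff:
  assumes "distinct p" "i < length p" "j < length p"
  shows "node p i \<subset> node p j \<longleftrightarrow> i < j"
  using nth_mem_node_iff[OF assms(1,2), of j] nth_mem_node_iff[OF assms(1,2), of i]
    nth_mem_node_iff[OF assms(1,3), of i] nth_mem_node_iff[OF assms(1,3), of j]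
    node_mono[of i j p] node_mono[of j i p] by (cases "i < j") auto

lemma inj_on_node:
  assumes "distinct p"
  shows "inj_on (node p) {..<length p}"
proof (rule linorder_inj_onI')
  fix i j :: nat assume "i \<in> {..<length p}" "j \<in> {..<length p}" "i < j"
  then have "node p i \<subset> node p j" using node_psubset_iff[OF assms, of i j] by simp
  then show "node p i \<noteq> node p j" by blast
qed

lemma node_chain: "chain_subset (node p ` I)"
proof -
  have "node p i \<subseteq> node p j \<or> node p j \<subseteq> node p i" for i j
    using node_mono[of i j p] node_mono[of j i p] nat_le_linear[of i j] by blast
  then show ?thesis by (auto simp: chain_subset_def)
qed

lemma node_in_Pow: "p \<noteq> [] \<Longrightarrow> node p ` I \<subseteq> Pow (set p) - {{}}"
  using set_take_subset[of _ p] by (auto simp: node_def)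

text \<open>
  Together with \<open>hull_centroids_iff\<close> this describes the simplex of the subdivision belonging to \<open>p\<close>: it
  consists of the points whose coordinates decrease weakly along \<open>p\<close>.
\<close>

lemma levels_subset_nodes_iff:
  assumes p: "distinct p" and u: "\<And>v. v \<notin> set p \<Longrightarrow> u v = 0" "\<And>v. 0 \<le> u v"
  shows "levels u \<subseteq> node p ` {..<length p} \<longleftrightarrow> sorted_wrt (\<lambda>v w. u w \<le> u v) p"
proof
  assume L: "levels u \<subseteq> node p ` {..<length p}"
  show "sorted_wrt (\<lambda>v w. u w \<le> u v) p"
    unfolding sorted_wrt_iff_nth_less
  proof (intro allI impI)
    fix i j assume ij: "i < j" "j < length p"
    show "u (p ! j) \<le> u (p ! i)"
    proof (rule ccontr)
      assume n: "\<not> u (p ! j) \<le> u (p ! i)"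
      then have "0 < u (p ! j)" using u(2)[of "p ! i"] by linarith
      then have "{v. u (p ! j) \<le> u v} \<in> levels u" by (auto simp: levels_def)
      then obtain k where k: "{v. u (p ! j) \<le> u v} = node p k" using L by auto
      moreover have "p ! j \<in> {v. u (p ! j) \<le> u v}" "p ! i \<notin> {v. u (p ! j) \<le> u v}" using n by auto
      ultimately show False using nth_mem_node_iff[OF p, of j k] nth_mem_node_iff[OF p, of i k] ij by auto
    qed
  qed
next
  assume "sorted_wrt (\<lambda>v w. u w \<le> u v) p"
  then have S: "u (p ! j) \<le> u (p ! i)" if "i \<le> j" "j < length p" for i j
    using that by (cases "i = j") (auto simp: sorted_wrt_iff_nth_less)
  show "levels u \<subseteq> node p ` {..<length p}"
  proof
    fix W assume "W \<in> levels u"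
    then obtain w where w: "W = {v. u w \<le> u v}" "0 < u w" by (auto simp: levels_def)
    have "W \<subseteq> set p" using w u(1) by force
    \<comment> \<open>the level set at \<open>w\<close> ends at the last position with a coordinate of at least \<open>u w\<close>\<close>
    define J where "J = {j. j < length p \<and> u w \<le> u (p ! j)}"
    have "w \<in> set p" using w u(1) by force
    then have "J \<noteq> {}" by (auto simp: J_def in_set_conv_nth)
    moreover have "finite J" by (simp add: J_def)
    ultimately have k: "Max J \<in> J" "\<And>j. j \<in> J \<Longrightarrow> j \<le> Max J" by auto
    have "W = node p (Max J)"
    proof (intro equalityI subsetI)
      fix v assume "v \<in> W"
      then obtain j where "j < length p" "v = p ! j" using \<open>W \<subseteq> set p\<close> by (metis in_set_conv_nth subsetD)
      moreover from this have "j \<in> J" using \<open>v \<in> W\<close> w by (simp add: J_def)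
      ultimately show "v \<in> node p (Max J)" using k(2) by (auto simp: mem_node_iff)
    next
      fix v assume "v \<in> node p (Max J)"
      then obtain j where "j \<le> Max J" "v = p ! j" by (auto simp: mem_node_iff)
      then have "u (p ! Max J) \<le> u v" using S k(1) by (simp add: J_def)
      then show "v \<in> W" using k(1) w by (simp add: J_def)
    qed
    then show "W \<in> node p ` {..<length p}" using k(1) by (auto simp: J_def)
  qed
qed

text \<open>
  An initial segment of \<open>p\<close> is a level set iff the coordinates drop strictly at its end. At the end of the
  list the drop is to \<open>0\<close>.
\<close>

lemma node_in_levels_iff:
  assumes p: "distinct p" and u: "\<And>v. v \<notin> set p \<Longrightarrow> u v = 0" "\<And>v. 0 \<le> u v"
    and sorted: "sorted_wrt (\<lambda>v w. u w \<le> u v) p" and i: "i < length p"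
  shows "node p i \<in> levels u \<longleftrightarrow> 0 < u (p ! i) \<and> (Suc i < length p \<longrightarrow> u (p ! Suc i) < u (p ! i))"
proof
  assume "node p i \<in> levels u"
  then obtain w where w: "node p i = {v. u w \<le> u v}" "0 < u w" by (auto simp: levels_def)
  have "p ! i \<in> node p i" using nth_mem_node_iff[OF p i] by simp
  then have "u w \<le> u (p ! i)" using w by simp
  moreover have "u (p ! Suc i) < u w" if "Suc i < length p"
  proof -
    have "p ! Suc i \<notin> node p i" using nth_mem_node_iff[OF p that] by simp
    then show ?thesis using w by simp
  qed
  ultimately show "0 < u (p ! i) \<and> (Suc i < length p \<longrightarrow> u (p ! Suc i) < u (p ! i))"
    using w by fastforce
next
  assume R: "0 < u (p ! i) \<and> (Suc i < length p \<longrightarrow> u (p ! Suc i) < u (p ! i))"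
  have S: "u (p ! j) \<le> u (p ! i)" if "i \<le> j" "j < length p" for i j
    using that sorted by (cases "i = j") (auto simp: sorted_wrt_iff_nth_less)
  have "node p i = {v. u (p ! i) \<le> u v}"
  proof (intro equalityI subsetI)
    fix v assume "v \<in> node p i"
    then show "v \<in> {v. u (p ! i) \<le> u v}" using S i by (auto simp: mem_node_iff)
  next
    fix v assume v: "v \<in> {v. u (p ! i) \<le> u v}"
    then have "v \<in> set p" using R u(1) by force
    then obtain j where j: "j < length p" "v = p ! j" by (auto simp: in_set_conv_nth)
    have "j \<le> i"
    proof (rule ccontr)
      assume "\<not> j \<le> i"
      then have "u (p ! j) \<le> u (p ! Suc i)" "Suc i < length p" using S[of "Suc i" j] j by auto
      then show False using R v j by auto
    qed
    then show "v \<in> node p i" using j by (auto simp: mem_node_iff)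
  qed
  then show "node p i \<in> levels u" using R by (auto simp: levels_def)
qed

text \<open>
  Sorting by decreasing \<open>u\<close>, with ties broken by increasing rank.
\<close>

definition before :: "('a \<Rightarrow> nat) \<Rightarrow> ('a \<Rightarrow> real) \<Rightarrow> 'a \<Rightarrow> 'a \<Rightarrow> bool" where
  "before r u v w \<longleftrightarrow> u w < u v \<or> u v = u w \<and> r v < r w"

definition descents :: "('a \<Rightarrow> nat) \<Rightarrow> 'a list \<Rightarrow> nat set" where
  "descents r p = {i. Suc i < length p \<and> r (p ! Suc i) < r (p ! i)}"

lemma transp_before: "transp (before r u)"
  by (rule transpI) (auto simp: before_def)

text \<open>
  Once \<open>u\<close> decreases weakly along \<open>p\<close>, the ties are in the right order iff no tie occurs at a descent of the
  ranks. These strict inequalities are the removed facets of the piece of \<open>p\<close>.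
\<close>

lemma sorted_wrt_before_iff:
  assumes "distinct p" "inj_on r (set p)"
  shows "sorted_wrt (before r u) p \<longleftrightarrow>
    sorted_wrt (\<lambda>v w. u w \<le> u v) p \<and> (\<forall>i\<in>descents r p. u (p ! Suc i) < u (p ! i))"
proof -
  have tr: "transp (\<lambda>v w. u w \<le> u v)" by (rule transpI) auto
  have r: "r (p ! i) \<noteq> r (p ! Suc i)" if "Suc i < length p" for i
    using assms that nth_eq_iff_index_eq[OF assms(1), of i "Suc i"] by (auto dest!: inj_onD)
  show ?thesis
    unfolding sorted_wrt_iff_nth_Suc_transp[OF tr] sorted_wrt_iff_nth_Suc_transp[OF transp_before]
      before_def descents_def
    using r by (auto simp: le_less) (metis linorder_neqE_nat)+
qed

lemma no_descents_imp_le: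
  assumes "i \<le> j" "j < length p" "\<And>k. i \<le> k \<Longrightarrow> k < j \<Longrightarrow> k \<notin> descents r p"
  shows "r (p ! i) \<le> r (p ! j)"
  using assms
proof (induction j rule: dec_induct)
  case (step j)
  have "j \<notin> descents r p" using step by auto
  then have "r (p ! j) \<le> r (p ! Suc j)" using step.prems by (auto simp: descents_def)
  then show ?case using step by auto
qed simp

lemma descents_imp_less:
  assumes "i < j" "j < length p" "{i..<j} \<subseteq> descents r p"
  shows "r (p ! j) < r (p ! i)"
  using assms
proof (induction j)
  case (Suc j)
  have "j \<in> {i..<Suc j}" using Suc.prems by simp
  then have j: "r (p ! Suc j) < r (p ! j)" using Suc.prems(3) unfolding descents_def by blast
  show ?case
  proof (cases "i = j")
    case False
    then have "r (p ! j) < r (p ! i)" using Suc.prems by (intro Suc.IH) auto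
    then show ?thesis using j by simp
  qed (use j in simp)
qed simp

section \<open>The pieces of a tile\<close>

text \<open>
  A tile with a ranking of its vertices. That \<open>R\<close> is on top ensures that a vertex of \<open>R\<close> followed by no descent
  forces the last vertex to be in \<open>R\<close>; that \<open>M - R\<close> is at the bottom ensures that a regular tile has no
  critical piece.
\<close>

locale ranked_tile =
  fixes n :: nat and V R M :: "'a::euclidean_space set" and r :: "'a \<Rightarrow> nat"
  assumes data: "tile_data n V R M"
    and inj: "inj_on r V"
    and R_top: "\<And>v w. v \<in> V - R \<Longrightarrow> w \<in> R \<Longrightarrow> r v < r w"
    and M_bot: "\<And>v w. v \<in> M - R \<Longrightarrow> w \<in> V - M \<Longrightarrow> r v < r w"
begin

lemma vertex_set: "\<not> affine_dependent V" "card V = n + 1" "R \<subseteq> V" "M \<subseteq> V" "finite V"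
  using data by (auto simp: tile_data_def intro: aff_independent_finite)

lemma morse_face: "M \<noteq> {} \<Longrightarrow> R \<noteq> {} \<and> R \<subseteq> M \<and> card M < n"
  using data by (simp add: tile_data_def)

definition first_outside :: "'a list \<Rightarrow> nat" where
  "first_outside p = (LEAST i. p ! i \<notin> M)"

text \<open>
  The positions of the vertices of the simplex of \<open>p\<close> opposite to the removed facets of its piece. If the
  last vertex of \<open>p\<close> is in \<open>R\<close>, its coordinate must be positive, which excludes the facet opposite to
  the centroid of the whole simplex.
\<close>

definition facet_indices :: "'a list \<Rightarrow> nat set" where
  "facet_indices p = descents r p \<union> (if p ! n \<in> R then {n} else {})"

text \<open>
  The positions of the vertices of the Morse face of the piece of \<open>p\<close>. They span the part of the simplex of
  \<open>p\<close> contained in the Morse face of the tile. If there is a descent at or beyond \<open>first_outside p\<close>, or if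
  the last vertex lies in \<open>R\<close>, this part is already contained in the removed facets.
\<close>

definition morse_indices :: "'a list \<Rightarrow> nat set" where
  "morse_indices p = (if p ! n \<notin> R \<and> descents r p \<subseteq> {..<first_outside p} then {..<first_outside p} else {})"

definition vertex :: "'a list \<Rightarrow> nat \<Rightarrow> 'a" where
  "vertex p i = centroid (node p i)"

definition piece :: "'a list \<Rightarrow> 'a set" where
  "piece p = {x \<in> tile V R M. sorted_wrt (before r (bcoord V x)) p}"

text \<open>
  The only ordering of the vertices which may yield a critical piece: first \<open>R\<close> with decreasing rank, then the
  other vertices with increasing rank.
\<close>

definition critical_before :: "'a \<Rightarrow> 'a \<Rightarrow> bool" where
  "critical_before v w \<longleftrightarrow> v \<in> R \<and> w \<notin> R \<or> v \<in> R \<and> w \<in> R \<and> r w < r v \<or> v \<notin> R \<and> w \<notin> R \<and> r v < r w"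

lemma transp_critical_before: "transp critical_before"
  by (rule transpI) (auto simp: critical_before_def)

context
  fixes p assumes p_perm: "p \<in> permutations_of_set V"
begin

lemma perm: "distinct p" "set p = V" "length p = Suc n" "p \<noteq> []"
  using permutations_of_setD[OF p_perm] vertex_set distinct_card[of p] by auto

lemma nth_in: "i \<le> n \<Longrightarrow> p ! i \<in> V"
  using perm nth_mem[of i p] by simp

lemma nth_ex: "v \<in> V \<Longrightarrow> \<exists>i\<le>n. v = p ! i"
  using perm in_set_conv_nth[of v p] by (auto simp: less_Suc_eq_le)

lemma descents_less: "descents r p \<subseteq> {..<n}"
  using perm by (auto simp: descents_def)

text \<open>
  Unless \<open>M\<close> is empty there are at least two vertices outside \<open>M\<close>, so that the first of them is not the last
  vertex of \<open>p\<close>. This gives codimension two for the new Morse faces.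
\<close>

lemma first_outside_spec:
  shows "first_outside p \<le> n" "p ! first_outside p \<notin> M" "\<And>i. i < first_outside p \<Longrightarrow> p ! i \<in> M"
    "M \<noteq> {} \<Longrightarrow> first_outside p < n"
proof -
  have "M \<noteq> V" using morse_face vertex_set by (cases "M = {}") auto
  then obtain i where i: "i \<le> n" "p ! i \<notin> M" using vertex_set(4) nth_ex by blast
  show 1: "p ! first_outside p \<notin> M" unfolding first_outside_def by (rule LeastI[of _ i]) (rule i)
  have "first_outside p \<le> i" unfolding first_outside_def by (rule Least_le) (rule i)
  then show "first_outside p \<le> n" using i by simp
  show 2: "p ! i \<in> M" if "i < first_outside p" for i
    using not_less_Least[of i "\<lambda>i. p ! i \<notin> M"] that unfolding first_outside_def by blast
  show "first_outside p < n" if "M \<noteq> {}"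
  proof (rule ccontr)
    assume "\<not> first_outside p < n"
    then have "(!) p ` {..<n} \<subseteq> M" using 2 by auto
    then have "card ((!) p ` {..<n}) \<le> card M" using vertex_set finite_subset by (intro card_mono) auto
    moreover have "inj_on ((!) p) {..<n}" using perm by (auto intro!: inj_on_nth)
    ultimately show False using morse_face[OF that] by (simp add: card_image)
  qed
qed

text \<open>
  Without descents the rank increases up to the end of the list, and nothing outside \<open>R\<close> outranks an element
  of \<open>R\<close>.
\<close>

lemma late_R_imp_last_R:
  assumes "i \<le> n" "p ! i \<in> R" "\<And>k. i \<le> k \<Longrightarrow> k < n \<Longrightarrow> k \<notin> descents r p"
  shows "p ! n \<in> R"
proof (rule ccontr)
  assume "p ! n \<notin> R"
  then have "r (p ! n) < r (p ! i)" using R_top nth_in assms by auto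
  moreover have "r (p ! i) \<le> r (p ! n)" using assms perm by (intro no_descents_imp_le) auto
  ultimately show False by simp
qed

lemma inj_on_vertex: "inj_on (vertex p) {..n}"
proof -
  have "{..n} = {..<length p}" using perm by auto
  then have "inj_on (node p) {..n}" using inj_on_node perm by metis
  moreover have "inj_on centroid (node p ` {..n})"
    using inj_on_centroid[OF vertex_set(1)] node_in_Pow[OF perm(4)] perm(2) by (metis inj_on_subset)
  ultimately have "inj_on (centroid \<circ> node p) {..n}" by (rule comp_inj_on)
  then show ?thesis by (simp add: vertex_def[abs_def] comp_def)
qed

lemma facet_indices_subset: "facet_indices p \<subseteq> {..n}" and morse_indices_subset: "morse_indices p \<subseteq> {..n}"
  using descents_less first_outside_spec(1) by (auto simp: facet_indices_def morse_indices_def)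

lemma mem_hull_vertices_iff:
  "x \<in> convex hull (vertex p ` I) \<longleftrightarrow> x \<in> convex hull V \<and> levels (bcoord V x) \<subseteq> node p ` I"
  using hull_centroids_iff[OF vertex_set(1) _ node_chain, of p I x] node_in_Pow[OF perm(4), of I] perm(2)
  by (simp add: vertex_def[abs_def] image_image)

lemma tile_data_piece: "tile_data n (vertex p ` {..n}) (vertex p ` facet_indices p) (vertex p ` morse_indices p)"
  unfolding tile_data_def
proof (intro conjI impI)
  show "\<not> affine_dependent (vertex p ` {..n})"
    using affine_independent_centroids[OF vertex_set(1) _ node_chain, of p "{..n}"] node_in_Pow[OF perm(4), of "{..n}"] perm(2)
    by (simp add: vertex_def[abs_def] image_image)
  show "card (vertex p ` {..n}) = n + 1" using inj_on_vertex by (simp add: card_image)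
  show "vertex p ` facet_indices p \<subseteq> vertex p ` {..n}" using facet_indices_subset by blast
  show "vertex p ` morse_indices p \<subseteq> vertex p ` {..n}" using morse_indices_subset by blast
  assume "vertex p ` morse_indices p \<noteq> {}"
  then have ne: "morse_indices p \<noteq> {}" by simp
  then have f: "p ! n \<notin> R" "descents r p \<subseteq> {..<first_outside p}" "morse_indices p = {..<first_outside p}"
    by (auto simp: morse_indices_def split: if_splits)
  then have "0 < first_outside p" using ne by (cases "first_outside p") auto
  then have "M \<noteq> {}" using first_outside_spec(3) by auto
  then obtain v where "v \<in> R" using morse_face by auto
  then obtain i where i: "i \<le> n" "p ! i \<in> R" using nth_ex vertex_set by blast
  have eq: "facet_indices p = descents r p" using f by (simp add: facet_indices_def)
  show "vertex p ` facet_indices p \<noteq> {}"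
    using late_R_imp_last_R[OF i] f eq by auto
  show "vertex p ` facet_indices p \<subseteq> vertex p ` morse_indices p" using f eq by auto
  show "card (vertex p ` morse_indices p) < n"
    using first_outside_spec(4)[OF \<open>M \<noteq> {}\<close>] f card_image_le[of "{..<first_outside p}" "vertex p"] by auto
qed

text \<open>
  For \<open>x\<close> in the simplex of \<open>p\<close>, let \<open>A\<close> be the set of positions at which its coordinates drop; both
  sides become conditions on \<open>A\<close>. If the last vertex is in \<open>R\<close>, then \<open>x\<close> is in the tile iff all its coordinates are positive. Otherwise,
  strict drops at all descents already make the coordinates positive on \<open>R\<close>, and \<open>x\<close> is in the tile
  iff its coordinate at the first vertex outside \<open>M\<close> is positive.
\<close>

lemma piece_eq_tile: "piece p = tile (vertex p ` {..n}) (vertex p ` facet_indices p) (vertex p ` morse_indices p)"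
proof (rule set_eqI)
  fix x
  define T where "T = tile (vertex p ` {..n}) (vertex p ` facet_indices p) (vertex p ` morse_indices p)"
  have "vertex p ` {..n} - {vertex p i} = vertex p ` ({..n} - {i})" if "i \<in> facet_indices p" for i
    using inj_on_vertex facet_indices_subset that by (auto simp: inj_on_eq_iff)
  then have T: "x \<in> T \<longleftrightarrow> x \<in> convex hull (vertex p ` {..n}) \<and>
      (\<forall>i\<in>facet_indices p. x \<notin> convex hull (vertex p ` ({..n} - {i}))) \<and> x \<notin> convex hull (vertex p ` morse_indices p)"
    by (auto simp: T_def tile_def)
  define u where "u = bcoord V x"
  have len: "{..<length p} = {..n}" using perm by auto
  have "x \<in> piece p \<longleftrightarrow> x \<in> T"
  proof (cases "x \<in> convex hull V \<and> sorted_wrt (\<lambda>v w. u w \<le> u v) p")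
    case False
    then have "x \<notin> piece p"
      using sorted_wrt_before_iff[of p r u] perm inj by (auto simp: piece_def tile_def u_def)
    moreover have "x \<notin> T"
    proof
      assume "x \<in> T"
      then have x: "x \<in> convex hull V" "levels u \<subseteq> node p ` {..<length p}"
        using T mem_hull_vertices_iff len by (auto simp: u_def)
      moreover have "sorted_wrt (\<lambda>v w. u w \<le> u v) p"
        using levels_subset_nodes_iff[of p u] bcoord_convex_hull(1,2)[OF vertex_set(1) x(1)] perm x(2) by (simp add: u_def)
      ultimately show False using False by simp
    qed
    ultimately show ?thesis by simp
  next
    case True
    then have x: "x \<in> convex hull V" and so: "sorted_wrt (\<lambda>v w. u w \<le> u v) p" by auto
    have u: "\<And>v. 0 \<le> u v" "\<And>v. v \<notin> set p \<Longrightarrow> u v = 0"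
      using bcoord_convex_hull(1,2)[OF vertex_set(1) x] perm by (auto simp: u_def)
    have S: "u (p ! j) \<le> u (p ! i)" if "i \<le> j" "j \<le> n" for i j
      using that so perm by (cases "i = j") (auto simp: sorted_wrt_iff_nth_less)
    define A where "A = {i. i \<le> n \<and> node p i \<in> levels u}"
    have A: "i \<in> A \<longleftrightarrow> 0 < u (p ! i) \<and> (i < n \<longrightarrow> u (p ! Suc i) < u (p ! i))" if "i \<le> n" for i
      using node_in_levels_iff[OF perm(1) u(2,1) so, of i] perm that by (auto simp: A_def)
    have "levels u \<subseteq> node p ` {..n}"
      using levels_subset_nodes_iff[of p u] u so perm(1) len by auto
    then have lev: "levels u = node p ` A" by (auto simp: A_def)
    have "inj_on (node p) {..n}" using inj_on_node[OF perm(1)] len by simp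
    then have hull: "x \<in> convex hull (vertex p ` I) \<longleftrightarrow> A \<subseteq> I" if "I \<subseteq> {..n}" for I
      unfolding mem_hull_vertices_iff u_def[symmetric] lev
      using inj_on_image_subset_iff[of "node p" "{..n}" A I] that x by (auto simp: A_def)
    have "A \<subseteq> {..n}" by (auto simp: A_def)
    then have T': "x \<in> T \<longleftrightarrow> facet_indices p \<subseteq> A \<and> \<not> A \<subseteq> morse_indices p"
      using T hull facet_indices_subset morse_indices_subset by auto
    have desc: "(\<forall>i\<in>descents r p. u (p ! Suc i) < u (p ! i)) \<longleftrightarrow> descents r p \<subseteq> A"
    proof -
      have "u (p ! Suc i) < u (p ! i) \<longleftrightarrow> i \<in> A" if "i \<in> descents r p" for i
        using A[of i] that descents_less u(1)[of "p ! Suc i"] by (auto simp: subset_iff)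
      then show ?thesis by auto
    qed
    have P: "x \<in> piece p \<longleftrightarrow> (\<forall>v\<in>R. 0 < u v) \<and> (\<exists>v. v \<notin> M \<and> 0 < u v) \<and> descents r p \<subseteq> A"
      using sorted_wrt_before_iff[of p r u] perm inj so x mem_tile_iff[OF vertex_set(1,3,4), of x] desc
      by (auto simp: piece_def u_def)
    show ?thesis
    proof (cases "p ! n \<in> R")
      case last: True
      then have eq: "facet_indices p = insert n (descents r p)" "morse_indices p = {}"
        by (auto simp: facet_indices_def morse_indices_def)
      have nA: "n \<in> A \<longleftrightarrow> 0 < u (p ! n)" using A[of n] by simp
      have "0 < u v" if "0 < u (p ! n)" "v \<in> V" for v
        using nth_ex[OF that(2)] that(1) S[of _ n] by fastforce
      then have "(\<forall>v\<in>R. 0 < u v) \<and> (\<exists>v. v \<notin> M \<and> 0 < u v)" if "0 < u (p ! n)"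
        using that vertex_set(3) nth_in[OF first_outside_spec(1)] first_outside_spec(2) by blast
      then show ?thesis unfolding P T' eq using nA last by auto
    next
      case last: False
      then have eq: "facet_indices p = descents r p" by (simp add: facet_indices_def)
      define m where "m = first_outside p"
      have Rpos: "\<forall>v\<in>R. 0 < u v" if D: "descents r p \<subseteq> A"
      proof
        fix v assume "v \<in> R"
        then obtain i where i: "i \<le> n" "v = p ! i" using nth_ex vertex_set by blast
        show "0 < u v"
        proof (rule ccontr)
          assume "\<not> 0 < u v"
          then have "\<not> 0 < u (p ! k)" if "i \<le> k" "k \<le> n" for k using S[OF that] i by simp
          then have "k \<notin> descents r p" if "i \<le> k" "k < n" for k
            using A[of k] D that by auto
          then show False using late_R_imp_last_R[OF i(1)] i \<open>v \<in> R\<close> last by blast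
        qed
      qed
      have mA: "0 < u (p ! m) \<longleftrightarrow> \<not> A \<subseteq> {..<m}"
      proof
        assume pos: "0 < u (p ! m)"
        \<comment> \<open>the coordinates drop to \<open>0\<close> after the last position where they are positive\<close>
        define J where "J = {j. j \<le> n \<and> 0 < u (p ! j)}"
        have "finite J" "m \<in> J" using pos first_outside_spec(1) by (auto simp: J_def m_def)
        then have k: "Max J \<in> J" "m \<le> Max J" using Max_in[of J] Max_ge[of J m] by blast+
        moreover have "Max J \<in> A"
        proof -
          have "Suc (Max J) \<notin> J" using Max_ge[OF \<open>finite J\<close>, of "Suc (Max J)"] by auto
          then have "\<not> 0 < u (p ! Suc (Max J))" if "Max J < n" using that by (auto simp: J_def)
          then show ?thesis using A[of "Max J"] k(1) by (fastforce simp: J_def)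
        qed
        ultimately show "\<not> A \<subseteq> {..<m}" by auto
      next
        assume "\<not> A \<subseteq> {..<m}"
        then obtain i where "i \<in> A" "m \<le> i" by (metis lessThan_iff not_le subsetI)
        then show "0 < u (p ! m)" using A[of i] S[of m i] by (force simp: A_def)
      qed
      have ex: "(\<exists>v. v \<notin> M \<and> 0 < u v) \<longleftrightarrow> 0 < u (p ! m)"
      proof
        assume "\<exists>v. v \<notin> M \<and> 0 < u v"
        then obtain v where v: "v \<notin> M" "0 < u v" by blast
        then have "v \<in> V" using u(2) perm by force
        then obtain i where i: "i \<le> n" "v = p ! i" using nth_ex by blast
        then have "m \<le> i" using first_outside_spec(3)[of i] v by (auto simp: m_def not_less[symmetric])
        then show "0 < u (p ! m)" using S[of m i] i v by simp
      next
        show "0 < u (p ! m) \<Longrightarrow> \<exists>v. v \<notin> M \<and> 0 < u v" using first_outside_spec(2) by (auto simp: m_def)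
      qed
      have "\<not> A \<subseteq> {..<m} \<longleftrightarrow> \<not> A \<subseteq> morse_indices p" if "descents r p \<subseteq> A"
      proof (cases "descents r p \<subseteq> {..<m}")
        case True
        then show ?thesis using last by (simp add: morse_indices_def m_def)
      next
        case False
        then have "morse_indices p = {}" by (simp add: morse_indices_def m_def)
        then show ?thesis using False that by auto
      qed
      then show ?thesis unfolding P T' eq ex mA using Rpos by blast
    qed
  qed
  then show "x \<in> piece p \<longleftrightarrow> x \<in> tile (vertex p ` {..n}) (vertex p ` facet_indices p) (vertex p ` morse_indices p)"
    by (simp add: T_def)
qed

lemma card_vertex_image: "I \<subseteq> {..n} \<Longrightarrow> card (vertex p ` I) = card I"
  using inj_on_vertex by (auto intro!: card_image elim: inj_on_subset)

lemma adjacent: "Suc i \<le> n \<Longrightarrow> p ! i \<in> V \<and> p ! Suc i \<in> V \<and> r (p ! i) \<noteq> r (p ! Suc i)"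
  using nth_in[of i] nth_in[of "Suc i"] inj_onD[OF inj, of "p ! i" "p ! Suc i"]
    nth_eq_iff_index_eq[OF perm(1), of i "Suc i"] perm(3) by auto

lemma descents_iff: "i \<in> descents r p \<longleftrightarrow> i < n \<and> r (p ! Suc i) < r (p ! i)"
  using perm by (auto simp: descents_def)

lemma sorted_critical_before_iff: "sorted_wrt critical_before p \<longleftrightarrow> (\<forall>i<n. critical_before (p ! i) (p ! Suc i))"
  using sorted_wrt_iff_nth_Suc_transp[OF transp_critical_before, of p] perm by auto

text \<open>
  The positions of the elements of \<open>R\<close> are closed downwards, hence form an initial segment.
\<close>

lemma sorted_critical_before_imp_initial_R:
  assumes so: "sorted_wrt critical_before p" and i: "i \<le> n"
  shows "p ! i \<in> R \<longleftrightarrow> i < card R"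
proof -
  define J where "J = {j. j \<le> n \<and> p ! j \<in> R}"
  have down: "j \<in> J" if "j \<le> i" "i \<in> J" for i j
  proof (cases "j = i")
    case False
    then have "critical_before (p ! j) (p ! i)" using so that perm by (auto simp: J_def sorted_wrt_iff_nth_less)
    then show ?thesis using that by (auto simp: critical_before_def J_def)
  qed (use that in simp)
  have "(!) p ` J = R" using nth_ex vertex_set(3) by (force simp: J_def)
  moreover have "inj_on ((!) p) J" using perm by (auto intro!: inj_on_nth simp: J_def)
  ultimately have c: "card J = card R" using card_image by fastforce
  have fin: "finite J" by (simp add: J_def)
  have "i \<in> J \<longleftrightarrow> i < card J"
  proof
    assume "i \<in> J"
    then have "{..i} \<subseteq> J" using down by auto
    then have "card {..i} \<le> card J" using fin by (rule card_mono[rotated])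
    then show "i < card J" by simp
  next
    assume *: "i < card J"
    show "i \<in> J"
    proof (rule ccontr)
      assume "i \<notin> J"
      then have "J \<subseteq> {..<i}" using down by (meson lessThan_iff not_le subsetI)
      then have "card J \<le> i" using card_mono[of "{..<i}" J] by simp
      then show False using * by simp
    qed
  qed
  then show ?thesis using c i by (simp add: J_def)
qed

text \<open>
  The three kinds of critical tiles correspond to each other. A piece of order \<open>0\<close> has no descents and last
  vertex outside \<open>R\<close>, so \<open>R\<close> is empty. A piece of order \<open>n + 1\<close> has descents everywhere and last vertex
  in \<open>R\<close>, so \<open>R\<close> contains everything. In the remaining case the descents are all the positions before
  the first vertex outside \<open>M\<close>; that vertex then has the lowest rank of all, which is only possible if
  \<open>M - R\<close> is empty, and the tile is critical too.
\<close>

lemma critical_piece_data_iff: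
  "critical_data n (card (facet_indices p)) (card (morse_indices p)) i \<longleftrightarrow>
     critical_data n (card R) (card M) i \<and> sorted_wrt critical_before p"
proof
  assume "critical_data n (card R) (card M) i \<and> sorted_wrt critical_before p"
  then have c: "critical_data n (card R) (card M) i" and so: "sorted_wrt critical_before p" by auto
  note init = sorted_critical_before_imp_initial_R[OF so]
  have step: "critical_before (p ! j) (p ! Suc j)" if "j < n" for j using so sorted_critical_before_iff that by blast
  have D: "j \<in> descents r p \<longleftrightarrow> j < n \<and> j < card R" for j
    using step[of j] init[of j] init[of "Suc j"] R_top[of "p ! Suc j" "p ! j"] adjacent[of j]
    by (auto simp: descents_iff critical_before_def)
  have "card R \<le> n + 1" using vertex_set card_mono by metis
  consider "card R = 0" "i = 0" | "card R = n + 1" "i = n"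
    | "1 \<le> card R" "card R < n" "card M = card R" "i = card R"
    using c by (auto simp: critical_data_def)
  then show "critical_data n (card (facet_indices p)) (card (morse_indices p)) i"
  proof cases
    case 1
    then have "facet_indices p = {}" using D init[of n] by (auto simp: facet_indices_def)
    then show ?thesis using 1 by (simp add: critical_data_def)
  next
    case 2
    have "descents r p = {..<n}" "p ! n \<in> R"
      unfolding set_eq_iff D init[OF order_refl] 2 by auto
    then have "facet_indices p = insert n {..<n}" by (simp add: facet_indices_def)
    also have "insert n {..<n} = {..n}" by auto
    finally show ?thesis using 2 by (simp add: critical_data_def)
  next
    case 3
    then have "M \<noteq> {}" by auto
    then have "M = R" using morse_face 3(3) vertex_set finite_subset card_subset_eq by metis
    have D': "descents r p = {..<card R}"
    proof (rule set_eqI)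
      show "j \<in> descents r p \<longleftrightarrow> j \<in> {..<card R}" for j unfolding D using 3(2) by auto
    qed
    have n: "p ! n \<notin> R" using init[of n] 3 by simp
    have "\<not> first_outside p < card R"
      using first_outside_spec(1,2) init[of "first_outside p"] \<open>M = R\<close> by simp
    moreover have "\<not> card R < first_outside p"
      using first_outside_spec(3)[of "card R"] init[of "card R"] 3(2) \<open>M = R\<close> by auto
    ultimately have "first_outside p = card R" by simp
    then have "facet_indices p = {..<card R}" "morse_indices p = {..<card R}"
      using D' n by (auto simp: facet_indices_def morse_indices_def)
    then show ?thesis using 3 by (simp add: critical_data_def)
  qed
next
  assume c: "critical_data n (card (facet_indices p)) (card (morse_indices p)) i"
  have fin: "finite (facet_indices p)" using facet_indices_subset finite_subset by blast
  consider "card (facet_indices p) = 0" "i = 0" | "card (facet_indices p) = n + 1" "i = n"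
    | "1 \<le> card (facet_indices p)" "card (facet_indices p) < n" "card (morse_indices p) = card (facet_indices p)"
      "i = card (facet_indices p)"
    using c unfolding critical_data_def by metis
  then show "critical_data n (card R) (card M) i \<and> sorted_wrt critical_before p"
  proof cases
    case 1
    then have "facet_indices p = {}" using fin by simp
    then have D: "descents r p = {}" "p ! n \<notin> R" by (auto simp: facet_indices_def split: if_splits)
    have "R = {}"
    proof (rule ccontr)
      assume "R \<noteq> {}"
      then obtain j where "j \<le> n" "p ! j \<in> R" using nth_ex vertex_set(3) by blast
      then show False using late_R_imp_last_R[of j] D by auto
    qed
    have "r (p ! j) < r (p ! Suc j)" if "j < n" for j
      using adjacent[of j] D(1) descents_iff[of j] that by auto
    then have "critical_before (p ! j) (p ! Suc j)" if "j < n" for j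
      using \<open>R = {}\<close> that unfolding critical_before_def by blast
    then have "sorted_wrt critical_before p" by (simp add: sorted_critical_before_iff)
    moreover have "card R = 0" using \<open>R = {}\<close> by simp
    ultimately show ?thesis using 1 by (simp add: critical_data_def)
  next
    case 2
    then have "facet_indices p = {..n}" using facet_indices_subset by (intro card_subset_eq) auto
    then have D: "descents r p = {..<n}" "p ! n \<in> R"
      using descents_less by (auto simp: facet_indices_def split: if_splits)
    have inR: "p ! j \<in> R" if "j \<le> n" for j
    proof (rule ccontr)
      assume "p ! j \<notin> R"
      moreover have "j \<noteq> n" using D(2) \<open>p ! j \<notin> R\<close> by metis
      ultimately have "r (p ! j) < r (p ! n)" "j < n" using R_top[of "p ! j" "p ! n"] nth_in[of j] that D(2) by simp_all
      moreover have "r (p ! n) < r (p ! j)"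
        by (rule descents_imp_less[OF \<open>j < n\<close>]) (auto simp: D(1) perm(3))
      ultimately show False by simp
    qed
    then have R: "R = V" using nth_ex vertex_set(3) by blast
    have "r (p ! Suc j) < r (p ! j)" if "j < n" for j using D descents_iff[of j] that by auto
    then have "critical_before (p ! j) (p ! Suc j)" if "j < n" for j
      using that inR[of j] inR[of "Suc j"] by (simp add: critical_before_def)
    then have "sorted_wrt critical_before p" by (simp add: sorted_critical_before_iff)
    moreover have "card R = n + 1" using R vertex_set(2) by simp
    ultimately show ?thesis using 2 by (simp add: critical_data_def)
  next
    case 3
    define m where "m = first_outside p"
    have "morse_indices p \<noteq> {}" using 3 by auto
    then have f: "p ! n \<notin> R" "descents r p \<subseteq> {..<m}" "morse_indices p = {..<m}"
      by (auto simp: morse_indices_def m_def split: if_splits)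
    then have eq: "facet_indices p = descents r p" by (simp add: facet_indices_def)
    have D: "descents r p = {..<m}" using f 3 eq by (intro card_subset_eq) auto
    have m: "card (facet_indices p) = m" using eq D by simp
    then have mn: "1 \<le> m" "m < n" using 3 by auto
    have asc: "r (p ! j) \<le> r (p ! k)" if "m \<le> j" "j \<le> k" "k \<le> n" for j k
      by (rule no_descents_imp_le) (use that in \<open>auto simp: D perm(3)\<close>)
    \<comment> \<open>the ranks decrease before position \<open>m\<close> and increase after it\<close>
    have min: "r (p ! m) \<le> r v" if "v \<in> V" for v
    proof -
      obtain j where j: "j \<le> n" "v = p ! j" using nth_ex[OF \<open>v \<in> V\<close>] by blast
      show ?thesis
      proof (cases "m \<le> j")
        case False
        then have "j < m" by simp
        then have "r (p ! m) < r (p ! j)"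
          by (rule descents_imp_less) (use mn in \<open>auto simp: D perm(3)\<close>)
        then show ?thesis using j by simp
      qed (use j asc[of m j] in simp)
    qed
    have "M \<subseteq> R"
    proof
      fix v assume "v \<in> M"
      show "v \<in> R"
      proof (rule ccontr)
        assume "v \<notin> R"
        moreover have "p ! m \<in> V - M" using first_outside_spec(1,2) nth_in by (simp add: m_def)
        ultimately have "r v < r (p ! m)" using M_bot[of v "p ! m"] \<open>v \<in> M\<close> by simp
        moreover have "r (p ! m) \<le> r v" using min \<open>v \<in> M\<close> vertex_set(4) by (simp add: subset_iff)
        ultimately show False by simp
      qed
    qed
    moreover have "M \<noteq> {}" using first_outside_spec(3)[of 0] mn by (auto simp: m_def)
    ultimately have MR: "R = M" using morse_face by (intro equalityI) simp_all
    have R_iff: "p ! j \<in> R \<longleftrightarrow> j < m" if "j \<le> n" for j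
    proof
      assume "p ! j \<in> R"
      show "j < m"
      proof (rule ccontr)
        assume "\<not> j < m"
        then have "r (p ! j) \<le> r (p ! n)" using asc[of j n] that by simp
        moreover have "r (p ! n) < r (p ! j)"
          using R_top[of "p ! n" "p ! j"] f(1) \<open>p ! j \<in> R\<close> nth_in[of n] by simp
        ultimately show False by simp
      qed
    next
      assume "j < m"
      then have "p ! j \<in> M" unfolding m_def by (rule first_outside_spec(3))
      then show "p ! j \<in> R" unfolding MR .
    qed
    have "(!) p ` {..<m} = R"
    proof
      show "(!) p ` {..<m} \<subseteq> R" using R_iff mn(2) by (intro image_subsetI) simp
      show "R \<subseteq> (!) p ` {..<m}"
      proof
        fix v assume "v \<in> R"
        then have "v \<in> V" using vertex_set(3) by blast
        then obtain j where j: "j \<le> n" "v = p ! j" using nth_ex[of v] by blast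
        then have "j \<in> {..<m}" using R_iff[of j] \<open>v \<in> R\<close> by simp
        then show "v \<in> (!) p ` {..<m}" unfolding j(2) by (rule imageI)
      qed
    qed
    moreover have "inj_on ((!) p) {..<m}"
      by (rule inj_on_nth[OF perm(1)]) (use mn perm(3) in auto)
    ultimately have cR: "card R = m" using card_image[of "(!) p" "{..<m}"] by simp
    then have "card M = m" using MR by simp
    then have "critical_data n (card R) (card M) i"
      unfolding cR using 3(4) m mn by (simp add: critical_data_def)
    moreover have "critical_before (p ! j) (p ! Suc j)" if "j < n" for j
    proof -
      have "r (p ! Suc j) < r (p ! j) \<longleftrightarrow> j < m" using descents_iff[of j] D that by simp
      then show ?thesis
        using R_iff[of j] R_iff[of "Suc j"] that adjacent[of j] unfolding critical_before_def by auto
    qed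
    ultimately show ?thesis by (simp add: sorted_critical_before_iff)
  qed
qed

end

lemma ex1_critical_before_sorted: "\<exists>!p. p \<in> permutations_of_set V \<and> sorted_wrt critical_before p"
proof (rule ex1_sorted_permutation[OF vertex_set(5) transp_critical_before])
  show "critical_before v w \<or> critical_before w v" if "v \<in> V" "w \<in> V" "v \<noteq> w" for v w
  proof -
    have "r v < r w \<or> r w < r v" using inj_onD[OF inj _ that(1,2)] that(3) by (meson linorder_neqE_nat)
    then show ?thesis by (auto simp: critical_before_def)
  qed
qed (auto simp: critical_before_def)

text \<open>
  Inversions are taken with respect to the ranking of the vertices.
\<close>

definition inversions :: "'a list \<Rightarrow> ('a \<times> 'a) set" where
  "inversions p = {(v, w). r v < r w \<and> (\<exists>i j. i < j \<and> j < length p \<and> p ! i = w \<and> p ! j = v)}"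

lemma inversionsI: "r (p ! j) < r (p ! i) \<Longrightarrow> i < j \<Longrightarrow> j < length p \<Longrightarrow> (p ! j, p ! i) \<in> inversions p"
  unfolding inversions_def by (intro CollectI case_prodI conjI exI[of _ i] exI[of _ j]) simp_all

lemma finite_inversions: "finite (inversions p)"
proof (rule finite_subset)
  show "inversions p \<subseteq> set p \<times> set p" by (auto simp: inversions_def)
qed simp

text \<open>
  The inversions tell for each pair of vertices which one comes first.
\<close>

lemma inversions_inject:
  assumes p: "p \<in> permutations_of_set V" and q: "q \<in> permutations_of_set V" and eq: "inversions p = inversions q"
  shows "p = q"
proof -
  define P where "P = (\<lambda>v w. r v < r w \<and> (v, w) \<notin> inversions p \<or> r w < r v \<and> (w, v) \<in> inversions p)"
  have "sorted_wrt P p'" if p': "p' \<in> permutations_of_set V" and inv: "inversions p' = inversions p" for p'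
    unfolding sorted_wrt_iff_nth_less
  proof (intro allI impI)
    fix i j assume ij: "i < j" "j < length p'"
    have d: "distinct p'" "set p' = V" using permutations_of_setD[OF p'] by auto
    have "p' ! i \<in> V" "p' ! j \<in> V" "p' ! i \<noteq> p' ! j"
      using ij d(2) nth_mem[of i p'] nth_mem[of j p'] nth_eq_iff_index_eq[OF d(1), of i j] by auto
    then have "r (p' ! i) \<noteq> r (p' ! j)" using inj inj_on_eq_iff by metis
    moreover have "(p' ! j, p' ! i) \<in> inversions p" if "r (p' ! j) < r (p' ! i)"
      using inversionsI[OF that ij] inv by simp
    moreover have "(p' ! i, p' ! j) \<notin> inversions p"
    proof
      assume "(p' ! i, p' ! j) \<in> inversions p"
      then have "\<exists>a b. a < b \<and> b < length p' \<and> p' ! a = p' ! j \<and> p' ! b = p' ! i"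
        unfolding inv[symmetric] by (simp add: inversions_def)
      then obtain a b where ab: "a < b" "b < length p'" "p' ! a = p' ! j" "p' ! b = p' ! i"
        by (elim exE conjE)
      then have "a = j" "b = i"
        using nth_eq_iff_index_eq[OF d(1), of a j] nth_eq_iff_index_eq[OF d(1), of b i] ij by simp_all
      then show False using ab ij by simp
    qed
    ultimately show "P (p' ! i) (p' ! j)" unfolding P_def by (meson linorder_neqE_nat)
  qed
  then have "sorted_wrt P p" "sorted_wrt P q" using p q eq by auto
  moreover have "set p = set q" using p q by (auto dest: permutations_of_setD)
  moreover have "\<not> P w v" if "P v w" for v w using that by (auto simp: P_def)
  ultimately show ?thesis using sorted_wrt_unique[of P p q] by blast
qed

text \<open>
  Sorting the ties of an ordering along which \<open>u\<close> decreases weakly can only remove inversions.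
\<close>

lemma inversions_sorted_subset:
  assumes p: "p \<in> permutations_of_set V" and q: "q \<in> permutations_of_set V"
    and "sorted_wrt (before r u) q" "sorted_wrt (\<lambda>v w. u w \<le> u v) p"
  shows "inversions q \<subseteq> inversions p"
proof safe
  fix v w assume "(v, w) \<in> inversions q"
  then obtain i j where ij: "r v < r w" "i < j" "j < length q" "q ! i = w" "q ! j = v"
    by (auto simp: inversions_def)
  then have "before r u w v" using assms(3) by (auto simp: sorted_wrt_iff_nth_less)
  then have uvw: "u v < u w" using ij by (auto simp: before_def)
  have "set p = set q" using p q by (auto dest: permutations_of_setD)
  then have "v \<in> set p" "w \<in> set p" using ij nth_mem[of i q] nth_mem[of j q] by auto
  then obtain a b where ab: "a < length p" "p ! a = w" "b < length p" "p ! b = v"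
    by (metis in_set_conv_nth)
  have "\<not> b < a" using assms(4) ab uvw by (force simp: sorted_wrt_iff_nth_less)
  moreover have "a \<noteq> b" using ab uvw by auto
  ultimately have "a < b" by simp
  then show "(v, w) \<in> inversions p" using inversionsI[of p b a] ab ij(1) by simp
qed

lemma ex1_before_sorted: "\<exists>!p. p \<in> permutations_of_set V \<and> sorted_wrt (before r u) p"
proof (rule ex1_sorted_permutation[OF vertex_set(5) transp_before])
  show "before r u v w \<or> before r u w v" if "v \<in> V" "w \<in> V" "v \<noteq> w" for v w
  proof -
    have "r v < r w \<or> r w < r v" using inj_onD[OF inj _ that(1,2)] that(3) by (meson linorder_neqE_nat)
    then show ?thesis by (auto simp: before_def)
  qed
qed (auto simp: before_def)

lemma Union_pieces: "(\<Union>p\<in>permutations_of_set V. piece p) = tile V R M"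
  using ex1_before_sorted by (fastforce simp: piece_def)

lemma pieces_disjoint:
  assumes "p \<in> permutations_of_set V" "q \<in> permutations_of_set V" "p \<noteq> q"
  shows "piece p \<inter> piece q = {}"
  using ex1_before_sorted assms by (auto simp: piece_def)

lemma piece_nonempty: "p \<in> permutations_of_set V \<Longrightarrow> piece p \<noteq> {}"
  using piece_eq_tile tile_nonempty[OF tile_data_piece] by simp

lemma inj_on_piece: "inj_on piece (permutations_of_set V)"
  using pieces_disjoint piece_nonempty by (intro inj_onI) (metis inf.idem)

lemma piece_subset_hull:
  assumes p: "p \<in> permutations_of_set V"
  shows "piece p \<subseteq> convex hull (vertex p ` {..n})"
  unfolding piece_eq_tile[OF p] tile_def by blast

lemma hull_vertices_imp_sorted:
  assumes pV: "p \<in> permutations_of_set V" and x: "x \<in> convex hull (vertex p ` {..n})"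
  shows "sorted_wrt (\<lambda>v w. bcoord V x w \<le> bcoord V x v) p"
proof -
  have len: "{..<length p} = {..n}" using perm[OF pV] by auto
  have "x \<in> convex hull V" "levels (bcoord V x) \<subseteq> node p ` {..<length p}"
    using x mem_hull_vertices_iff[OF pV] len by auto
  then show ?thesis
    using levels_subset_nodes_iff[of p "bcoord V x"] bcoord_convex_hull(1,2)[OF vertex_set(1)] perm[OF pV] by simp
qed

text \<open>
  For a family of orderings closed under removing inversions, the union of the pieces is the trace on the tile
  of the union of the corresponding closed simplices.
\<close>

lemma closedin_Union_pieces:
  assumes "Q \<subseteq> permutations_of_set V"
    and down: "\<And>p q. p \<in> Q \<Longrightarrow> q \<in> permutations_of_set V \<Longrightarrow> inversions q \<subset> inversions p \<Longrightarrow> q \<in> Q"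
  shows "closedin (top_of_set (tile V R M)) (\<Union>p\<in>Q. piece p)"
proof -
  have "(\<Union>p\<in>Q. piece p) = tile V R M \<inter> (\<Union>p\<in>Q. convex hull (vertex p ` {..n}))"
  proof (intro equalityI subsetI)
    fix x assume "x \<in> (\<Union>p\<in>Q. piece p)"
    then show "x \<in> tile V R M \<inter> (\<Union>p\<in>Q. convex hull (vertex p ` {..n}))"
      using piece_subset_hull assms(1) by (auto simp: piece_def)
  next
    fix x assume "x \<in> tile V R M \<inter> (\<Union>p\<in>Q. convex hull (vertex p ` {..n}))"
    then obtain p where x: "x \<in> tile V R M" and p: "p \<in> Q" "x \<in> convex hull (vertex p ` {..n})" by auto
    have pV: "p \<in> permutations_of_set V" using p assms by auto
    obtain q where q: "q \<in> permutations_of_set V" "sorted_wrt (before r (bcoord V x)) q"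
      using ex1_before_sorted by blast
    have "inversions q \<subseteq> inversions p"
      using inversions_sorted_subset[OF pV q] hull_vertices_imp_sorted[OF pV p(2)] .
    then have "q \<in> Q" using down[OF p(1) q(1)] inversions_inject[OF q(1) pV] p(1) by blast
    then show "x \<in> (\<Union>p\<in>Q. piece p)" using q x by (auto simp: piece_def)
  qed
  moreover have "closed (\<Union>p\<in>Q. convex hull (vertex p ` {..n}))"
  proof (rule closed_UN)
    show "finite Q" using assms(1) finite_permutations_of_set finite_subset by blast
  qed (simp add: compact_imp_closed finite_imp_compact_convex_hull)
  ultimately show ?thesis by (simp add: closedin_closed_Int)
qed

lemma critical_pieces_card:
  "card {p \<in> permutations_of_set V. critical_tile (piece p) i} = (if critical_tile (tile V R M) i then 1 else 0)"
proof -
  have "critical_tile (piece p) i \<longleftrightarrow> critical_tile (tile V R M) i \<and> sorted_wrt critical_before p"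
    if p: "p \<in> permutations_of_set V" for p
    unfolding piece_eq_tile[OF p] critical_tile_iff[OF tile_data_piece[OF p]] critical_tile_iff[OF data]
      card_vertex_image[OF p facet_indices_subset[OF p]] card_vertex_image[OF p morse_indices_subset[OF p]]
    by (rule critical_piece_data_iff[OF p])
  then have "{p \<in> permutations_of_set V. critical_tile (piece p) i} =
      (if critical_tile (tile V R M) i then {p \<in> permutations_of_set V. sorted_wrt critical_before p} else {})"
    by auto
  moreover obtain p0 where "{p \<in> permutations_of_set V. sorted_wrt critical_before p} = {p0}"
    using ex1_critical_before_sorted by blast
  ultimately show ?thesis by simp
qed

end

lemma ex_ranked_tile:
  fixes V :: "'a::euclidean_space set"
  assumes d: "tile_data n V R M"
  shows "\<exists>r. ranked_tile n V R M r"
proof -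
  have fin: "finite V" using d by (auto simp: tile_data_def intro: aff_independent_finite)
  obtain f where f: "bij_betw f V {0..<card V}" using ex_bij_betw_finite_nat[OF fin] by blast
  have f_less: "f v < card V" if "v \<in> V" for v using bij_betwE[OF f] that by auto
  \<comment> \<open>three blocks of width \<open>card V\<close>, in the order \<open>M - R\<close>, \<open>V - M\<close>, \<open>R\<close>\<close>
  define r where "r = (\<lambda>v. f v + (if v \<in> R then 2 * card V else if v \<in> M then 0 else card V))"
  have "ranked_tile n V R M r"
  proof
    show "inj_on r V"
    proof (rule inj_onI)
      fix v w assume vw: "v \<in> V" "w \<in> V" "r v = r w"
      then have "f v = f w" using f_less[of v] f_less[of w] by (auto simp: r_def split: if_splits)
      then show "v = w" using f vw by (auto simp: bij_betw_def dest: inj_onD)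
    qed
    show "r v < r w" if "v \<in> V - R" "w \<in> R" for v w
      using that f_less[of v] by (auto simp: r_def)
    show "r v < r w" if "v \<in> M - R" "w \<in> V - M" for v w
      using that f_less[of v] d by (auto simp: r_def tile_data_def)
  qed (rule d)
  then show ?thesis by blast
qed

text \<open>
  A Morse tile of the subdivision of \<open>convex hull V\<close>, whose vertices are the centroids of a chain of subsets of
  \<open>V\<close> and whose Morse face is spanned by the centroids of an initial segment of that chain. The last
  condition is what tameness requires.
\<close>

definition flag_tile :: "nat \<Rightarrow> 'a::euclidean_space set \<Rightarrow> 'a set \<Rightarrow> bool" where
  "flag_tile n V s \<longleftrightarrow> (\<exists>C R M. C \<subseteq> Pow V - {{}} \<and> chain_subset C \<and>
     tile_data n (centroid ` C) (centroid ` R) (centroid ` M) \<and>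
     s = tile (centroid ` C) (centroid ` R) (centroid ` M) \<and>
     M \<subseteq> C \<and> (\<forall>F\<in>C - M. \<forall>G\<in>M. G \<subset> F))"

text \<open>
  The list form of the closedness condition on the filtration of a shelling.
\<close>

definition closed_prefixes :: "'a::euclidean_space set list \<Rightarrow> bool" where
  "closed_prefixes ts \<longleftrightarrow>
     (\<forall>us vs. ts = us @ vs \<longrightarrow> closedin (top_of_set (\<Union>(set ts))) (\<Union>(set us)))"

lemma (in ranked_tile) flag_tile_piece:
  assumes pV: "p \<in> permutations_of_set V"
  shows "flag_tile n V (piece p)"
proof -
  have im: "vertex p ` I = centroid ` node p ` I" for I by (simp add: vertex_def[abs_def] image_image)
  note pp = perm[OF pV]
  have "node p j \<subset> node p i" if "i \<in> {..n} - morse_indices p" "j \<in> morse_indices p" for i j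
  proof -
    have "j < i" using that by (auto simp: morse_indices_def split: if_splits)
    then show ?thesis using that node_psubset_iff[OF pp(1), of j i] pp(3) by auto
  qed
  then have low: "\<forall>F\<in>node p ` {..n} - node p ` morse_indices p. \<forall>G\<in>node p ` morse_indices p. G \<subset> F"
    by blast
  have "node p ` {..n} \<subseteq> Pow V - {{}}" using node_in_Pow[OF pp(4)] pp(2) by metis
  moreover have "node p ` morse_indices p \<subseteq> node p ` {..n}" using morse_indices_subset[OF pV] by blast
  ultimately show ?thesis
    using low tile_data_piece[OF pV, unfolded im] piece_eq_tile[OF pV, unfolded im] node_chain[of p "{..n}"]
    unfolding flag_tile_def by blast
qed

text \<open>
  The pieces are listed by increasing number of inversions, which makes every initial segment of the list
  closed under removing inversions.
\<close>

lemma tile_subdivision: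
  fixes V :: "'a::euclidean_space set"
  assumes d: "tile_data n V R M"
  shows "\<exists>ts. distinct ts \<and> partition_on (tile V R M) (set ts) \<and> closed_prefixes ts \<and>
    (\<forall>s\<in>set ts. flag_tile n V s) \<and>
    (\<forall>i. card {s\<in>set ts. critical_tile s i} = (if critical_tile (tile V R M) i then 1 else 0))"
proof -
  obtain r where "ranked_tile n V R M r" using ex_ranked_tile[OF d] by blast
  then interpret ranked_tile n V R M r .
  define P where "P = permutations_of_set V"
  have "finite P" by (simp add: P_def)
  then obtain ps0 where ps0: "distinct ps0" "set ps0 = P" using finite_distinct_list by blast
  define ps where "ps = sort_key (card \<circ> inversions) ps0"
  have ps: "distinct ps" "set ps = P" "sorted (map (card \<circ> inversions) ps)" using ps0 by (simp_all add: ps_def)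
  define ts where "ts = map piece ps"
  have set_ts: "set ts = piece ` P" by (simp add: ts_def ps)
  have "distinct ts" using ps inj_on_piece by (simp add: ts_def distinct_map P_def)
  moreover have part: "partition_on (tile V R M) (set ts)"
  proof (rule partition_onI)
    show "\<Union>(set ts) = tile V R M" using Union_pieces by (simp add: set_ts P_def)
    show "{} \<notin> set ts" using piece_nonempty by (auto simp: set_ts P_def)
    show "disjnt s s'" if "s \<in> set ts" "s' \<in> set ts" "s \<noteq> s'" for s s'
      using that pieces_disjoint by (fastforce simp: set_ts P_def disjnt_def)
  qed
  moreover have "closed_prefixes ts"
    unfolding closed_prefixes_def partition_onD1[OF part, symmetric]
  proof (intro allI impI)
    fix us vs assume "ts = us @ vs"
    then obtain qs qs' where q: "ps = qs @ qs'" "us = map piece qs"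
      unfolding ts_def map_eq_append_conv by blast
    have "closedin (top_of_set (tile V R M)) (\<Union>p\<in>set qs. piece p)"
    proof (rule closedin_Union_pieces)
      show "set qs \<subseteq> permutations_of_set V" using ps q by (auto simp: P_def)
      fix p q' assume p: "p \<in> set qs" "q' \<in> permutations_of_set V" "inversions q' \<subset> inversions p"
      then have "card (inversions q') < card (inversions p)" by (intro psubset_card_mono finite_inversions)
      then have "q' \<notin> set qs'" using ps(3) p(1) q(1) by (fastforce simp: sorted_append)
      then show "q' \<in> set qs" using p(2) ps(2) q(1) by (auto simp: P_def)
    qed
    then show "closedin (top_of_set (tile V R M)) (\<Union>(set us))" using q by simp
  qed
  moreover have "\<forall>s\<in>set ts. flag_tile n V s" using flag_tile_piece by (auto simp: set_ts P_def)
  moreover have "card {s\<in>set ts. critical_tile s i} = (if critical_tile (tile V R M) i then 1 else 0)" for i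
  proof -
    have "{s\<in>set ts. critical_tile s i} = piece ` {p \<in> permutations_of_set V. critical_tile (piece p) i}"
      by (auto simp: set_ts P_def)
    moreover have "inj_on piece {p \<in> permutations_of_set V. critical_tile (piece p) i}"
      using inj_on_piece by (rule inj_on_subset) auto
    ultimately show ?thesis using critical_pieces_card[of i] by (simp add: card_image)
  qed
  ultimately show ?thesis by blast
qed

section \<open>The barycentric subdivision of a complex\<close>

lemma simplicial_complex_simplexE:
  assumes "simplicial_complex L" "\<sigma> \<in> L"
  obtains V where "\<not> affine_dependent V" "\<sigma> = convex hull V"
  using assms unfolding simplicial_complex_def simplex_def by metis

lemma simplicial_complex_faceD:
  assumes "simplicial_complex L" "\<sigma> \<in> L" "F face_of \<sigma>"
  shows "F \<in> L"
  using assms unfolding simplicial_complex_def by blast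

lemma simplicial_complex_Int:
  assumes "simplicial_complex L" "\<sigma> \<in> L" "\<tau> \<in> L"
  shows "\<sigma> \<inter> \<tau> face_of \<sigma>"
  using assms unfolding simplicial_complex_def by blast

lemma simplicial_complex_underlying:
  assumes K: "simplicial_complex K"
  shows "simplicial_complex (underlying_complex K S)"
  unfolding simplicial_complex_def
proof (intro conjI allI ballI impI)
  show "finite (underlying_complex K S)"
    using K by (simp add: simplicial_complex_def underlying_complex_def)
  show "\<exists>n. n simplex \<sigma>" if "\<sigma> \<in> underlying_complex K S" for \<sigma>
    using K that by (simp add: simplicial_complex_def underlying_complex_def)
  show "F \<in> underlying_complex K S" if "\<sigma> \<in> underlying_complex K S \<and> F face_of \<sigma>" for F \<sigma>
  proof -
    have s: "\<sigma> \<in> K" "\<sigma> \<subseteq> closure S" "F face_of \<sigma>" using that by (simp_all add: underlying_complex_def)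
    have "F \<in> K" by (rule simplicial_complex_faceD[OF K s(1,3)])
    moreover have "F \<subseteq> closure S" using face_of_imp_subset[OF s(3)] s(2) by (rule subset_trans)
    ultimately show ?thesis by (simp add: underlying_complex_def)
  qed
  show "\<sigma> \<inter> \<tau> face_of \<sigma>" if "\<sigma> \<in> underlying_complex K S \<and> \<tau> \<in> underlying_complex K S" for \<sigma> \<tau>
    using simplicial_complex_Int[OF K] that by (simp add: underlying_complex_def)
qed

lemma hull_subset_of_complex:
  assumes L: "simplicial_complex L" "convex hull V \<in> L" "\<sigma> \<in> L" "\<sigma> \<subseteq> convex hull V" and V: "\<not> affine_dependent V"
  shows "\<exists>W\<subseteq>V. \<sigma> = convex hull W"
proof -
  have "convex hull V \<inter> \<sigma> face_of convex hull V" using simplicial_complex_Int L by blast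
  moreover have "convex hull V \<inter> \<sigma> = \<sigma>" using L by blast
  ultimately show ?thesis using face_of_convex_hull_affine_independent[OF V] by auto
qed

text \<open>
  All simplices of a chain are faces of the greatest one, so the chain becomes a chain of subsets of a single
  affinely independent set.
\<close>

lemma chain_of_simplices:
  assumes L: "simplicial_complex L" and C: "C \<subseteq> L - {{}}" "chain_subset C" "C \<noteq> {}"
  obtains V D where "\<not> affine_dependent V" "convex hull V \<in> L" "D \<subseteq> Pow V - {{}}" "chain_subset D"
    "C = (hull) convex ` D" "barycenter ` C = centroid ` D"
proof -
  have "finite L" using L by (simp add: simplicial_complex_def)
  then have "finite C" using C finite_subset by blast
  then obtain \<sigma> where s: "\<sigma> \<in> C" "\<And>\<tau>. \<tau> \<in> C \<Longrightarrow> \<tau> \<subseteq> \<sigma>" using finite_chain_has_greatest C by metis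
  have "\<sigma> \<in> L" using s(1) C(1) by auto
  then obtain V where V: "\<not> affine_dependent V" "\<sigma> = convex hull V" by (rule simplicial_complex_simplexE[OF L])
  define D where "D = {W. W \<subseteq> V \<and> convex hull W \<in> C}"
  have "C = (hull) convex ` D"
  proof
    show "C \<subseteq> (hull) convex ` D"
    proof
      fix \<tau> assume "\<tau> \<in> C"
      then obtain W where "W \<subseteq> V" "\<tau> = convex hull W"
        using hull_subset_of_complex[OF L _ _ _ V(1), of \<tau>] s V C by blast
      then show "\<tau> \<in> (hull) convex ` D" using \<open>\<tau> \<in> C\<close> by (auto simp: D_def)
    qed
  qed (auto simp: D_def)
  moreover have "D \<subseteq> Pow V - {{}}" using C by (auto simp: D_def)
  moreover have "chain_subset D"
    unfolding chain_subset_def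
  proof (intro ballI)
    fix A B assume "A \<in> D" "B \<in> D"
    then show "A \<subseteq> B \<or> B \<subseteq> A"
      using C(2) hull_subset_iff[OF V(1), of A B] hull_subset_iff[OF V(1), of B A]
      unfolding chain_subset_def D_def by blast
  qed
  moreover have "barycenter (convex hull W) = centroid W" if "W \<in> D" for W
  proof -
    have "W \<subseteq> V" using that by (simp add: D_def)
    then have "\<not> affine_dependent W" using V(1) affine_dependent_subset by blast
    then show ?thesis by (rule barycenter_hull)
  qed
  ultimately show thesis using that[of V D] V s C by (auto simp: image_image)
qed

lemma hull_centroids_in_subdivision:
  assumes L: "simplicial_complex L" and V: "\<not> affine_dependent V" "convex hull V \<in> L"
    and D: "D \<subseteq> Pow V - {{}}" "chain_subset D"
  shows "convex hull (centroid ` D) \<in> barycentric_subdivision L"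
proof -
  define C where "C = (hull) convex ` D"
  have "convex hull W face_of convex hull V" if "W \<in> D" for W
    using that D face_of_convex_hull_affine_independent[OF V(1)] by blast
  then have "C \<subseteq> L - {{}}" using D simplicial_complex_faceD[OF L V(2)] by (auto simp: C_def)
  moreover have "chain_subset C"
    using D(2) hull_mono[of _ _ convex] unfolding chain_subset_def C_def by (metis (no_types, lifting) imageE)
  moreover have "barycenter ` C = centroid ` D"
  proof -
    have "barycenter (convex hull W) = centroid W" if "W \<in> D" for W
    proof (rule barycenter_hull)
      have "W \<subseteq> V" using that D by auto
      then show "\<not> affine_dependent W" using V(1) affine_dependent_subset by blast
    qed
    then show ?thesis by (auto simp: C_def image_image)
  qed
  ultimately show ?thesis unfolding barycentric_subdivision_def by (metis (mono_tags, lifting) mem_Collect_eq)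
qed

lemma barycentric_subdivisionE:
  assumes L: "simplicial_complex L" and P: "P \<in> barycentric_subdivision L" "P \<noteq> {}"
  obtains V D where "\<not> affine_dependent V" "convex hull V \<in> L" "D \<subseteq> Pow V - {{}}" "chain_subset D"
    "P = convex hull (centroid ` D)"
proof -
  obtain C where C: "P = convex hull (barycenter ` C)" "C \<subseteq> L - {{}}" "chain_subset C"
    using P by (auto simp: barycentric_subdivision_def)
  have "C \<noteq> {}" using C P by auto
  then show thesis using chain_of_simplices[OF L C(2,3)] C(1) that by metis
qed

text \<open>
  A point in both simplices lies in a common face of \<open>convex hull V\<close> and \<open>convex hull V'\<close>, so it has the same
  coordinates with respect to both, and its level sets belong to both chains.
\<close>

lemma hull_centroids_Int:
  assumes L: "simplicial_complex L"
    and V: "\<not> affine_dependent V" "convex hull V \<in> L" "D \<subseteq> Pow V - {{}}" "chain_subset D"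
    and V': "\<not> affine_dependent V'" "convex hull V' \<in> L" "D' \<subseteq> Pow V' - {{}}" "chain_subset D'"
  shows "convex hull (centroid ` D) \<inter> convex hull (centroid ` D') = convex hull (centroid ` (D \<inter> D'))"
proof
  have "convex hull V \<inter> convex hull V' face_of convex hull V" "convex hull V' \<inter> convex hull V face_of convex hull V'"
    using simplicial_complex_Int[OF L] V V' by blast+
  then obtain W W' where W: "W \<subseteq> V" "convex hull V \<inter> convex hull V' = convex hull W"
    and W': "W' \<subseteq> V'" "convex hull V \<inter> convex hull V' = convex hull W'"
    using face_of_convex_hull_affine_independent V(1) V'(1) by (metis Int_commute)
  have "\<not> affine_dependent W" "\<not> affine_dependent W'" using V(1) V'(1) W(1) W'(1) affine_dependent_subset by blast+
  then have "W = W'"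
    using W(2) W'(2) extreme_point_of_convex_hull_affine_independent[of W] extreme_point_of_convex_hull_affine_independent[of W']
    by auto
  have chain: "chain_subset (D \<inter> D')" using V(4) by (auto simp: chain_subset_def)
  have sub: "D \<inter> D' \<subseteq> Pow V - {{}}" using V(3) by auto
  show "convex hull (centroid ` D) \<inter> convex hull (centroid ` D') \<subseteq> convex hull (centroid ` (D \<inter> D'))"
  proof
    fix x assume "x \<in> convex hull (centroid ` D) \<inter> convex hull (centroid ` D')"
    then have x: "x \<in> convex hull V" "levels (bcoord V x) \<subseteq> D" "x \<in> convex hull V'" "levels (bcoord V' x) \<subseteq> D'"
      using hull_centroids_iff[OF V(1,3,4)] hull_centroids_iff[OF V'(1,3,4)] by auto
    then have "x \<in> convex hull W" using W by auto
    then have "bcoord V x = bcoord V' x"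
      using bcoord_subset[OF V(1) W(1)] bcoord_subset[OF V'(1) W'(1)] \<open>W = W'\<close> by simp
    then show "x \<in> convex hull (centroid ` (D \<inter> D'))"
      using x hull_centroids_iff[OF V(1) sub chain] by auto
  qed
  show "convex hull (centroid ` (D \<inter> D')) \<subseteq> convex hull (centroid ` D) \<inter> convex hull (centroid ` D')"
    by (simp add: hull_mono image_mono)
qed

lemma simplicial_complex_barycentric_subdivision:
  fixes L :: "'a::euclidean_space set set"
  assumes L: "simplicial_complex L"
  shows "simplicial_complex (barycentric_subdivision L)"
  unfolding simplicial_complex_def
proof (intro conjI ballI allI impI)
  have "barycentric_subdivision L \<subseteq> (\<lambda>C. convex hull (barycenter ` C)) ` Pow L"
    by (auto simp: barycentric_subdivision_def)
  moreover have "finite L" using L by (simp add: simplicial_complex_def)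
  ultimately show "finite (barycentric_subdivision L)" by (meson finite_Pow_iff finite_imageI finite_subset)
next
  fix P assume P: "P \<in> barycentric_subdivision L"
  show "\<exists>n. n simplex P"
  proof (cases "P = {}")
    case False
    obtain V D where D: "\<not> affine_dependent V" "convex hull V \<in> L" "D \<subseteq> Pow V - {{}}" "chain_subset D"
      "P = convex hull (centroid ` D)" using barycentric_subdivisionE[OF L P False] .
    have "int (card (centroid ` D)) = (int (card (centroid ` D)) - 1) + 1" by simp
    then show ?thesis using affine_independent_centroids[OF D(1,3,4)] D(5) unfolding simplex_def by blast
  qed (auto intro: exI[of _ "-1"])
next
  fix F P assume "P \<in> barycentric_subdivision L \<and> F face_of P"
  then have P: "P \<in> barycentric_subdivision L" "F face_of P" by auto
  show "F \<in> barycentric_subdivision L"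
  proof (cases "P = {}")
    case False
    obtain V D where D: "\<not> affine_dependent V" "convex hull V \<in> L" "D \<subseteq> Pow V - {{}}" "chain_subset D"
      "P = convex hull (centroid ` D)" using barycentric_subdivisionE[OF L P(1) False] .
    obtain B where "B \<subseteq> centroid ` D" "F = convex hull B"
      using P(2) D(5) face_of_convex_hull_affine_independent[OF affine_independent_centroids[OF D(1,3,4)]] by auto
    then obtain D' where D': "D' \<subseteq> D" "F = convex hull (centroid ` D')" by (metis subset_image_iff)
    have "D' \<subseteq> Pow V - {{}}" using D'(1) D(3) by blast
    moreover have "chain_subset D'" using D'(1) D(4) unfolding chain_subset_def by blast
    ultimately show ?thesis using hull_centroids_in_subdivision[OF L D(1,2)] D' by simp
  qed (use P in simp)
next
  fix P P' assume "P \<in> barycentric_subdivision L \<and> P' \<in> barycentric_subdivision L"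
  then have P: "P \<in> barycentric_subdivision L" "P' \<in> barycentric_subdivision L" by auto
  show "P \<inter> P' face_of P"
  proof (cases "P = {} \<or> P' = {}")
    case False
    obtain V D where D: "\<not> affine_dependent V" "convex hull V \<in> L" "D \<subseteq> Pow V - {{}}" "chain_subset D"
      "P = convex hull (centroid ` D)" using barycentric_subdivisionE[OF L P(1)] False by blast
    obtain V' D' where D': "\<not> affine_dependent V'" "convex hull V' \<in> L" "D' \<subseteq> Pow V' - {{}}" "chain_subset D'"
      "P' = convex hull (centroid ` D')" using barycentric_subdivisionE[OF L P(2)] False by blast
    have "P \<inter> P' = convex hull (centroid ` (D \<inter> D'))"
      unfolding D(5) D'(5) by (rule hull_centroids_Int[OF L D(1-4) D'(1-4)])
    moreover have "centroid ` (D \<inter> D') \<subseteq> centroid ` D" by blast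
    ultimately show ?thesis
      using D(5) face_of_convex_hull_affine_independent[OF affine_independent_centroids[OF D(1,3,4)]] by blast
  qed auto
qed

text \<open>
  A barycenter lies in no proper face of its simplex.
\<close>

lemma inj_on_barycenter:
  assumes L: "simplicial_complex L"
  shows "inj_on barycenter (L - {{}})"
proof -
  have sub: "G \<subseteq> H" if GH: "G \<in> L - {{}}" "H \<in> L - {{}}" "barycenter G = barycenter H" for G H
  proof -
    have "G \<in> L" "H \<in> L" using GH by auto
    obtain V where V: "\<not> affine_dependent V" "G = convex hull V"
      using \<open>G \<in> L\<close> by (rule simplicial_complex_simplexE[OF L])
    obtain U where U: "\<not> affine_dependent U" "H = convex hull U"
      using \<open>H \<in> L\<close> by (rule simplicial_complex_simplexE[OF L])
    have ne: "V \<noteq> {}" "U \<noteq> {}" using V U GH by auto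
    have "centroid V = centroid U"
      using GH(3) unfolding V(2) U(2) barycenter_hull[OF V(1)] barycenter_hull[OF U(1)] .
    then have x: "centroid V \<in> G \<inter> H"
      using centroid_in_hull ne aff_independent_finite V U by (metis IntI)
    have "G \<inter> H face_of G" using simplicial_complex_Int[OF L] GH by blast
    then obtain W where W: "W \<subseteq> V" "G \<inter> H = convex hull W"
      using face_of_convex_hull_affine_independent[OF V(1)] V(2) by auto
    then have "V \<subseteq> W" using x centroid_in_hull_iff[OF V(1) order_refl ne(1) W(1)] by simp
    then have "G \<inter> H = G" using W V by auto
    then show ?thesis by blast
  qed
  show ?thesis by (rule inj_onI) (use sub in \<open>metis subset_antisym\<close>)
qed

section \<open>The orientation of the subdivision\<close>

text \<open>
  Edges of the subdivision run from the barycenter of a simplex to the barycenters of its proper faces.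
\<close>

definition descent_orientation :: "'a::euclidean_space set set \<Rightarrow> 'a \<Rightarrow> 'a \<Rightarrow> bool" where
  "descent_orientation L v w \<longleftrightarrow>
     (\<exists>G H. G \<in> L - {{}} \<and> H \<in> L - {{}} \<and> H \<subset> G \<and> v = barycenter G \<and> w = barycenter H)"

lemma descent_orientation_barycenters:
  assumes "simplicial_complex L" "G \<in> L - {{}}" "H \<in> L - {{}}"
  shows "descent_orientation L (barycenter G) (barycenter H) \<longleftrightarrow> H \<subset> G"
  using assms inj_onD[OF inj_on_barycenter[OF assms(1)]] unfolding descent_orientation_def by metis

lemma edge_orientation_descent:
  assumes L: "simplicial_complex L"
  shows "edge_orientation (underlying_complex (barycentric_subdivision L) S) (descent_orientation L)"
  unfolding edge_orientation_def
proof (intro allI impI)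
  fix v w assume vw: "v \<noteq> w \<and> closed_segment v w \<in> underlying_complex (barycentric_subdivision L) S"
  then obtain C where C: "closed_segment v w = convex hull (barycenter ` C)" "C \<subseteq> L - {{}}" "chain_subset C"
    by (auto simp: underlying_complex_def barycentric_subdivision_def)
  have "C \<noteq> {}" using C(1) by auto
  then obtain V D where D: "\<not> affine_dependent V" "D \<subseteq> Pow V - {{}}" "chain_subset D" "barycenter ` C = centroid ` D"
    using chain_of_simplices[OF L C(2,3)] by metis
  have "x extreme_point_of closed_segment v w \<longleftrightarrow> x \<in> barycenter ` C" for x
    using extreme_point_of_convex_hull_affine_independent[OF affine_independent_centroids[OF D(1-3)]] D(4) C(1) by simp
  then have "v \<in> barycenter ` C" "w \<in> barycenter ` C" using extreme_point_of_segment by blast+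
  then obtain G H where GH: "G \<in> C" "v = barycenter G" "H \<in> C" "w = barycenter H" by auto
  then have "G \<noteq> H" "G \<subseteq> H \<or> H \<subseteq> G" using vw C(3) by (auto simp: chain_subset_def)
  then show "descent_orientation L v w \<longleftrightarrow> \<not> descent_orientation L w v"
    using descent_orientation_barycenters[OF L, of G H] descent_orientation_barycenters[OF L, of H G] GH C(2) by blast
qed

lemma descent_orientation_trans:
  assumes L: "simplicial_complex L" and uv: "descent_orientation L u v" and vw: "descent_orientation L v w"
  shows "descent_orientation L u w"
proof -
  obtain G H where GH: "G \<in> L - {{}}" "H \<in> L - {{}}" "H \<subset> G" "u = barycenter G" "v = barycenter H"
    using uv unfolding descent_orientation_def by blast
  obtain H' I where HI: "H' \<in> L - {{}}" "I \<in> L - {{}}" "I \<subset> H'" "v = barycenter H'" "w = barycenter I"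
    using vw unfolding descent_orientation_def by blast
  have "H = H'" using inj_onD[OF inj_on_barycenter[OF L], of H H'] GH HI by simp
  then show ?thesis using GH HI unfolding descent_orientation_def by blast
qed

lemma descent_orientation_irrefl:
  assumes "simplicial_complex L"
  shows "\<not> descent_orientation L v v"
  using inj_onD[OF inj_on_barycenter[OF assms]] unfolding descent_orientation_def by blast

text \<open>
  The orientation is transitive and irreflexive, hence has no oriented cycles; the Morse face of a flag tile is
  spanned by the barycenters of the smallest simplices of its chain, so edges point towards it.
\<close>

lemma tame_tiling_flag_tiles:
  fixes L :: "'a::euclidean_space set set"
  assumes L: "simplicial_complex L"
    and T: "\<And>s. s \<in> T \<Longrightarrow> \<exists>n V. \<not> affine_dependent V \<and> convex hull V \<in> L \<and> flag_tile n V s"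
  shows "tame_tiling (barycentric_subdivision L) S T"
  unfolding tame_tiling_def
proof (intro exI[of _ "descent_orientation L"] conjI allI impI ballI)
  show "edge_orientation (underlying_complex (barycentric_subdivision L) S) (descent_orientation L)"
    by (rule edge_orientation_descent[OF L])
  show "\<not> (descent_orientation L u v \<and> descent_orientation L v w \<and> descent_orientation L w u)" for u v w
    using descent_orientation_trans[OF L] descent_orientation_irrefl[OF L] by blast
  fix s n k \<sigma> \<mu> v w
  assume s: "s \<in> T" "morse_tile_of n k \<sigma> \<mu> s \<and> \<mu> \<noteq> {}"
    and vw: "v extreme_point_of \<sigma> \<and> v \<notin> \<mu> \<and> w extreme_point_of \<mu>"
  obtain n' V where V: "\<not> affine_dependent V" "convex hull V \<in> L" "flag_tile n' V s" using T[OF s(1)] by blast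
  then obtain C R M where C: "C \<subseteq> Pow V - {{}}" "tile_data n' (centroid ` C) (centroid ` R) (centroid ` M)"
    "s = tile (centroid ` C) (centroid ` R) (centroid ` M)" "M \<subseteq> C" "\<forall>F\<in>C - M. \<forall>G\<in>M. G \<subset> F"
    unfolding flag_tile_def by blast
  have sm: "\<sigma> = convex hull (centroid ` C)" "\<mu> = convex hull (centroid ` M)"
    using morse_tile_of_tile(1)[OF C(2)] s(2) C(3) by auto
  have ind: "\<not> affine_dependent (centroid ` C)" using C(2) by (simp add: tile_data_def)
  moreover have "centroid ` M \<subseteq> centroid ` C" using C(4) by blast
  ultimately have "\<not> affine_dependent (centroid ` M)" using affine_dependent_subset by blast
  then have "v \<in> centroid ` C" "w \<in> centroid ` M"
    using vw sm extreme_point_of_convex_hull_affine_independent ind by blast+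
  then obtain F G where FG: "F \<in> C" "v = centroid F" "G \<in> M" "w = centroid G" by blast
  have "v \<notin> centroid ` M" using vw sm hull_inc by metis
  then have "F \<notin> M" using FG by blast
  then have "G \<subset> F" using FG C by blast
  have FV: "F \<subseteq> V" "F \<noteq> {}" "G \<subseteq> V" "G \<noteq> {}" using FG C by auto
  have faces: "convex hull W \<in> L - {{}}" "barycenter (convex hull W) = centroid W" if "W \<subseteq> V" "W \<noteq> {}" for W
  proof -
    have "convex hull W face_of convex hull V" using that face_of_convex_hull_affine_independent[OF V(1)] by blast
    then show "convex hull W \<in> L - {{}}" using simplicial_complex_faceD[OF L V(2)] that by auto
    show "barycenter (convex hull W) = centroid W"
      using V(1) that affine_dependent_subset by (blast intro: barycenter_hull)
  qed
  have "convex hull G \<subset> convex hull F"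
    using \<open>G \<subset> F\<close> hull_subset_iff[OF V(1)] FV by (metis psubset_eq subset_antisym)
  then show "descent_orientation L v w"
    using descent_orientation_barycenters[OF L faces(1) faces(1), of F G] faces(2) FV FG by simp
qed

section \<open>Refining tilings and shellings\<close>

lemma partition_on_refine:
  assumes T: "partition_on S T" and g: "\<And>t. t \<in> T \<Longrightarrow> partition_on t (g t)"
  shows "partition_on S (\<Union>(g ` T))"
proof (rule partition_onI)
  have U: "\<Union>(g t) = t" "{} \<notin> g t" if "t \<in> T" for t using g[OF that] by (auto simp: partition_on_def)
  then show "\<Union>(\<Union>(g ` T)) = S" using partition_onD1[OF T] by fastforce
  show "{} \<notin> \<Union>(g ` T)" using U by blast
  fix p q assume "p \<in> \<Union>(g ` T)" "q \<in> \<Union>(g ` T)" "p \<noteq> q"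
  then obtain t t' where t: "t \<in> T" "p \<in> g t" "t' \<in> T" "q \<in> g t'" by blast
  show "disjnt p q"
  proof (cases "t = t'")
    case True
    then show ?thesis using partition_onD2[OF g[OF t(1)]] t \<open>p \<noteq> q\<close> by (auto simp: pairwise_def)
  next
    case False
    then have "disjnt t t'" using partition_onD2[OF T] t by (auto simp: pairwise_def)
    moreover have "p \<subseteq> t" "q \<subseteq> t'" using U t by blast+
    ultimately show ?thesis by (meson disjnt_subset1 disjnt_subset2)
  qed
qed

lemma partition_on_same_block:
  assumes "partition_on S T" "s \<in> T" "t \<in> T" "x \<in> s" "x \<in> t"
  shows "s = t"
  using partition_onD2[OF assms(1)] assms(2-) by (auto simp: pairwise_def disjnt_def)

text \<open>
  If \<open>P\<close> is the trace of a closed set \<open>E\<close> and \<open>B\<close> that of a closed set \<open>C\<close>, then \<open>P \<union> B\<close> is the trace of \<open>E \<union> C\<close>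
  on the closed set \<open>P \<union> t\<close>.
\<close>

lemma closedin_Un_refine:
  fixes P t B S :: "'a::euclidean_space set"
  assumes P: "closedin (top_of_set S) P" and Pt: "closedin (top_of_set S) (P \<union> t)"
    and B: "closedin (top_of_set t) B"
  shows "closedin (top_of_set S) (P \<union> B)"
proof -
  obtain E where E: "closed E" "P = S \<inter> E" using P by (auto simp: closedin_closed)
  obtain C where C: "closed C" "B = t \<inter> C" using B by (auto simp: closedin_closed)
  have "P \<union> t \<subseteq> S" using Pt closedin_subset by fastforce
  then have "P \<union> B = (P \<union> t) \<inter> (S \<inter> (E \<union> C))" using E C by blast
  moreover have "closedin (top_of_set S) (S \<inter> (E \<union> C))" using E C by (simp add: closed_Un closedin_closed_Int)
  ultimately show ?thesis using Pt by (simp add: closedin_Int)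
qed

text \<open>
  An initial segment of the concatenation consists of the complete subdivisions of an initial segment of \<open>ts\<close> and
  an initial segment of the subdivision of the next tile.
\<close>

lemma closed_prefixes_concat:
  assumes ts: "closed_prefixes ts" and g: "\<And>t. t \<in> set ts \<Longrightarrow> closed_prefixes (g t) \<and> \<Union>(set (g t)) = t"
  shows "closed_prefixes (concat (map g ts))"
proof -
  define S where "S = \<Union>(set ts)"
  have Ug: "\<Union>(set (concat (map g us))) = \<Union>(set us)" if "set us \<subseteq> set ts" for us
    using g that by auto blast+
  have S: "\<Union>(set (concat (map g ts))) = S" using Ug[of ts] by (simp add: S_def)
  have pre: "closedin (top_of_set S) (\<Union>(set us))" if "ts = us @ vs" for us vs
    using ts that unfolding closed_prefixes_def S_def by blast
  show ?thesis
    unfolding closed_prefixes_def S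
  proof (intro allI impI)
    fix us vs assume eq: "concat (map g ts) = us @ vs"
    show "closedin (top_of_set S) (\<Union>(set us))"
    proof (cases "ts = []")
      case True
      then show ?thesis using eq by simp
    next
      case False
      then obtain xss1 xs xs' xss2 where x: "map g ts = xss1 @ (xs @ xs') # xss2" "us = concat xss1 @ xs"
        using eq unfolding concat_eq_append_conv by auto
      then obtain ts1 t ts2 where t: "ts = ts1 @ t # ts2" "xss1 = map g ts1" "g t = xs @ xs'"
        by (auto simp: map_eq_append_conv map_eq_Cons_conv)
      have "closedin (top_of_set S) (\<Union>(set ts1) \<union> \<Union>(set xs))"
      proof (rule closedin_Un_refine)
        show "closedin (top_of_set S) (\<Union>(set ts1))" using pre t(1) .
        show "closedin (top_of_set S) (\<Union>(set ts1) \<union> t)"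
          using pre[of "ts1 @ [t]" ts2] t(1) by (simp add: Un_commute)
        show "closedin (top_of_set t) (\<Union>(set xs))"
          using g[of t] t unfolding closed_prefixes_def by auto
      qed
      moreover have "\<Union>(set us) = \<Union>(set ts1) \<union> \<Union>(set xs)"
        using Ug[of ts1] t x by auto
      ultimately show ?thesis by simp
    qed
  qed
qed

text \<open>
  The filtration of a shelling amounts to an enumeration of the tiles by its successive differences. These
  exhaust \<open>T\<close> because they already cover \<open>S\<close>.
\<close>

lemma morse_shelling_imp_list:
  fixes K :: "'a::euclidean_space set set"
  assumes sh: "morse_shelling K S T N A"
  obtains ts where "distinct ts" "set ts = T" "ts \<noteq> []" "closed_prefixes ts"
proof -
  have T: "partition_on S T" and N: "1 \<le> N" and AN: "A N = S" and A1: "A 1 \<in> T"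
    and A: "\<And>i. 1 \<le> i \<Longrightarrow> i \<le> N \<Longrightarrow> closedin (top_of_set S) (A i)"
    and step: "\<And>i. 2 \<le> i \<Longrightarrow> i \<le> N \<Longrightarrow> A (i - 1) \<subset> A i \<and> A i - A (i - 1) \<in> T"
    using sh by (auto simp: morse_shelling_def morse_tiling_def morse_tiled_subset_def)
  \<comment> \<open>the filtration starts at \<open>1\<close>, the enumeration of its differences at \<open>0\<close>\<close>
  define B where "B i = (if i = 0 then A 1 else A (Suc i) - A i)" for i
  have BT: "B i \<in> T" if "i < N" for i using that A1 step[of "Suc i"] by (cases i) (auto simp: B_def)
  have UB: "\<Union>(B ` {..<Suc k}) = A (Suc k)" if "k < N" for k
    using that
  proof (induction k)
    case (Suc k)
    then show ?case using step[of "Suc (Suc k)"] by (auto simp: B_def lessThan_Suc[of "Suc k"])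
  qed (simp add: B_def lessThan_Suc)
  have ne: "t \<noteq> {}" if "t \<in> T" for t using T that by (auto simp: partition_on_def)
  define ts where "ts = map B [0..<N]"
  have set_ts: "set ts = B ` {..<N}" by (auto simp: ts_def)
  have UN: "\<Union>(set ts) = S" using UB[of "N - 1"] N AN by (simp add: set_ts)
  have "set ts = T"
  proof
    show "set ts \<subseteq> T" using BT by (auto simp: set_ts)
    show "T \<subseteq> set ts"
    proof
      fix t assume t: "t \<in> T"
      then obtain x where x: "x \<in> t" using ne by blast
      then have "x \<in> \<Union>(set ts)" using t partition_onD1[OF T] UN by blast
      then obtain s where "s \<in> set ts" "x \<in> s" by blast
      then show "t \<in> set ts" using partition_on_same_block[OF T _ t _ x] \<open>set ts \<subseteq> T\<close> by blast
    qed
  qed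
  moreover have "inj_on B {0..<N}"
  proof (rule linorder_inj_onI')
    fix i j :: nat assume ij: "i \<in> {0..<N}" "j \<in> {0..<N}" "i < j"
    then obtain j' where j': "j = Suc j'" by (cases j) auto
    have "B i \<subseteq> A j" using UB[of j'] ij j' by auto
    moreover have "B j \<inter> A j = {}" using ij by (auto simp: B_def)
    ultimately show "B i \<noteq> B j" using BT[of j] ne[of "B j"] ij by auto
  qed
  then have "distinct ts" by (simp add: ts_def distinct_map)
  moreover have "ts \<noteq> []" using N by (simp add: ts_def)
  moreover have "closed_prefixes ts"
    unfolding closed_prefixes_def UN
  proof (intro allI impI)
    fix us vs assume eq: "ts = us @ vs"
    define k where "k = length us"
    have "k \<le> N" using eq by (auto simp: k_def ts_def dest: arg_cong[where f = length])
    have "us = take k ts" using eq by (simp add: k_def)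
    also have "\<dots> = map B [0..<k]" using \<open>k \<le> N\<close> by (simp add: ts_def take_map)
    finally have us: "set us = B ` {..<k}" by auto
    show "closedin (top_of_set S) (\<Union>(set us))"
    proof (cases k)
      case (Suc k')
      then show ?thesis using us UB[of k'] A[of k] \<open>k \<le> N\<close> by simp
    qed (simp add: us)
  qed
  ultimately show thesis using that by blast
qed

lemma list_imp_morse_shelling:
  fixes K :: "'a::euclidean_space set set"
  assumes til: "morse_tiling K S T" and ts: "distinct ts" "set ts = T" "ts \<noteq> []" "closed_prefixes ts"
  shows "morse_shelling K S T (length ts) (\<lambda>i. \<Union>(set (take i ts)))"
proof -
  have T: "partition_on S T" using til by (simp add: morse_tiling_def)
  then have S: "\<Union>(set ts) = S" and ne: "{} \<notin> T" using ts(2) by (auto simp: partition_on_def)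
  have closed: "morse_tiled_subset S T (\<Union>(set (take i ts)))" for i
    unfolding morse_tiled_subset_def
  proof (intro conjI exI)
    show "set (take i ts) \<subseteq> T" using ts(2) set_take_subset by metis
    show "closedin (top_of_set S) (\<Union>(set (take i ts)))"
      using ts(4) append_take_drop_id[of i ts] unfolding closed_prefixes_def S by metis
  qed simp
  have step: "\<Union>(set (take (i - 1) ts)) \<subset> \<Union>(set (take i ts)) \<and> \<Union>(set (take i ts)) - \<Union>(set (take (i - 1) ts)) \<in> T"
    if i: "i \<in> {2..length ts}" for i
  proof -
    obtain k where k: "i = Suc k" "k < length ts" using i by (cases i) auto
    define t where "t = ts ! k"
    have t: "t \<in> T" using k ts(2) by (auto simp: t_def)
    have ta: "set (take i ts) = insert t (set (take k ts))" using k by (simp add: take_Suc_conv_app_nth t_def)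
    have "t \<notin> set (take k ts)"
    proof
      assume "t \<in> set (take k ts)"
      then obtain j where "j < k" "t = ts ! j" using k by (auto simp: in_set_conv_nth)
      then show False using ts(1) k nth_eq_iff_index_eq[OF ts(1), of j k] by (simp add: t_def)
    qed
    then have "s \<inter> t = {}" if "s \<in> set (take k ts)" for s
      using partition_on_same_block[OF T _ t, of s] that ts(2) in_set_takeD[OF that] by blast
    then have "t \<inter> \<Union>(set (take k ts)) = {}" by blast
    moreover have "t \<noteq> {}" using t ne by auto
    ultimately have "\<Union>(set (take k ts)) \<subset> t \<union> \<Union>(set (take k ts))" "t \<union> \<Union>(set (take k ts)) - \<Union>(set (take k ts)) = t"
      by blast+
    then show ?thesis using t k(1) ta by simp
  qed
  have "\<Union>(set (take 1 ts)) \<in> T" using ts by (cases ts) auto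
  moreover have "1 \<le> length ts" using ts(3) by (cases ts) auto
  ultimately show ?thesis unfolding morse_shelling_def using til closed step S by simp
qed

section \<open>Assembling the pieces\<close>

lemma flag_tile_in_subdivision:
  fixes L :: "'a::euclidean_space set set"
  assumes L: "simplicial_complex L" and V: "\<not> affine_dependent V" "convex hull V \<in> L" and s: "flag_tile n V s"
  shows "\<exists>k. \<exists>\<sigma>\<in>barycentric_subdivision L. \<exists>\<mu>. morse_tile_of n k \<sigma> \<mu> s \<and> s \<subseteq> \<sigma>"
proof -
  obtain C R M where C: "C \<subseteq> Pow V - {{}}" "chain_subset C" "tile_data n (centroid ` C) (centroid ` R) (centroid ` M)"
    "s = tile (centroid ` C) (centroid ` R) (centroid ` M)"
    using s unfolding flag_tile_def by blast
  have "convex hull (centroid ` C) \<in> barycentric_subdivision L" by (rule hull_centroids_in_subdivision[OF L V C(1,2)])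
  moreover have "s \<subseteq> convex hull (centroid ` C)" unfolding C(4) tile_def by blast
  ultimately show ?thesis using morse_tile_of_tile(2)[OF C(3)] C(4) by blast
qed

lemma flag_tile_dim_iff:
  assumes "flag_tile n V s"
  shows "(\<exists>m\<ge>j. \<exists>k \<sigma> \<mu>. morse_tile_of m k \<sigma> \<mu> s) \<longleftrightarrow> j \<le> n"
proof -
  obtain C R M where C: "tile_data n (centroid ` C) (centroid ` R) (centroid ` M)"
    "s = tile (centroid ` C) (centroid ` R) (centroid ` M)"
    using assms unfolding flag_tile_def by blast
  show ?thesis using morse_tile_of_tile[OF C(1)] C(2) by blast
qed

text \<open>
  What has to be known about the subdivision of a single tile. The condition on the numbers \<open>j\<close> says that \<open>n\<close>
  is the dimension of \<open>t\<close>, so that the pieces have the same dimension as \<open>t\<close>.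
\<close>

definition subdivides_tile :: "'a::euclidean_space set set \<Rightarrow> 'a set \<Rightarrow> 'a set list \<Rightarrow> bool" where
  "subdivides_tile L t ts \<longleftrightarrow> distinct ts \<and> partition_on t (set ts) \<and> closed_prefixes ts \<and>
     (\<forall>i. card {s\<in>set ts. critical_tile s i} = (if critical_tile t i then 1 else 0)) \<and>
     (\<exists>n V. \<not> affine_dependent V \<and> convex hull V \<in> L \<and> (\<forall>s\<in>set ts. flag_tile n V s) \<and>
        (\<forall>j. (\<exists>m\<ge>j. \<exists>k \<sigma> \<mu>. morse_tile_of m k \<sigma> \<mu> t) \<longleftrightarrow> j \<le> n))"

text \<open>
  The simplex of a tile of \<open>S\<close> belongs to the underlying complex because the tile is dense in it.
\<close>

lemma ex_subdivides_tile:
  fixes K :: "'a::euclidean_space set set"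
  assumes til: "morse_tiling K S T" and t: "t \<in> T"
  shows "\<exists>ts. subdivides_tile (underlying_complex K S) t ts"
proof -
  obtain n k \<sigma> \<mu> where "\<sigma> \<in> K" "morse_tile_of n k \<sigma> \<mu> t"
    using til t unfolding morse_tiling_def by metis
  then obtain V R M where V: "tile_data n V R M" "convex hull V \<in> K" "t = tile V R M"
    unfolding morse_tile_of_iff by blast
  have "t \<subseteq> S" using til t by (auto simp: morse_tiling_def partition_on_def)
  then have "convex hull V \<subseteq> closure S" using closure_mono[of t S] closure_tile[OF V(1)] V(3) by simp
  then have L: "convex hull V \<in> underlying_complex K S" using V(2) by (simp add: underlying_complex_def)
  have dim: "(\<exists>m\<ge>j. \<exists>k \<sigma> \<mu>. morse_tile_of m k \<sigma> \<mu> t) \<longleftrightarrow> j \<le> n" for j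
    using morse_tile_of_tile[OF V(1)] V(3) by blast
  have "\<not> affine_dependent V" using V(1) by (simp add: tile_data_def)
  with tile_subdivision[OF V(1)] L dim show ?thesis
    unfolding subdivides_tile_def V(3)[symmetric] by blast
qed

locale tiled_subdivision =
  fixes K :: "'a::euclidean_space set set" and S :: "'a set" and T :: "'a set set"
    and g :: "'a set \<Rightarrow> 'a set list"
  assumes tiling: "morse_tiling K S T"
    and g: "\<And>t. t \<in> T \<Longrightarrow> subdivides_tile (underlying_complex K S) t (g t)"
begin

abbreviation "L \<equiv> underlying_complex K S"

definition "T' = (\<Union>t\<in>T. set (g t))"

lemma complex_L: "simplicial_complex L"
proof (rule simplicial_complex_underlying)
  show "simplicial_complex K" using tiling unfolding morse_tiling_def by (rule conjunct1)
qed

lemma partition_T: "partition_on S T"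
  using tiling by (simp add: morse_tiling_def)

lemma gD:
  assumes "t \<in> T"
  shows "distinct (g t)" "partition_on t (set (g t))" "closed_prefixes (g t)"
    "card {s\<in>set (g t). critical_tile s i} = (if critical_tile t i then 1 else 0)"
  using g[OF assms] by (simp_all add: subdivides_tile_def)

lemma partition_T': "partition_on S T'"
  unfolding T'_def by (rule partition_on_refine[OF partition_T]) (rule gD(2))

lemma piece_subset: "t \<in> T \<Longrightarrow> s \<in> set (g t) \<Longrightarrow> s \<subseteq> t"
  using gD(2) by (auto simp: partition_on_def)

lemma g_disjoint:
  assumes "t \<in> T" "t' \<in> T" "s \<in> set (g t)" "s \<in> set (g t')"
  shows "t = t'"
proof -
  have "s \<noteq> {}" using gD(2)[OF assms(1)] assms(3) by (auto simp: partition_on_def)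
  then obtain x where "x \<in> s" by blast
  then have "x \<in> t" "x \<in> t'" using piece_subset assms by blast+
  then show ?thesis using partition_on_same_block[OF partition_T] assms by blast
qed

lemma flag_tiles: "s \<in> T' \<Longrightarrow> \<exists>n V. \<not> affine_dependent V \<and> convex hull V \<in> L \<and> flag_tile n V s"
  using g unfolding T'_def subdivides_tile_def by blast

lemma tiling': "morse_tiling (barycentric_subdivision L) S T'"
  unfolding morse_tiling_def
proof (intro conjI ballI allI)
  show "simplicial_complex (barycentric_subdivision L)" by (rule simplicial_complex_barycentric_subdivision[OF complex_L])
  have tile: "\<exists>n k. \<exists>\<sigma>\<in>barycentric_subdivision L. \<exists>\<mu>. morse_tile_of n k \<sigma> \<mu> s \<and> s \<subseteq> \<sigma>" if "s \<in> T'" for s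
    using flag_tiles[OF that] flag_tile_in_subdivision[OF complex_L] by blast
  have "s \<subseteq> \<Union>(barycentric_subdivision L)" if "s \<in> T'" for s using tile[OF that] by blast
  then show "S \<subseteq> \<Union>(barycentric_subdivision L)" using partition_onD1[OF partition_T'] by blast
  show "\<exists>n k. \<exists>\<sigma>\<in>barycentric_subdivision L. \<exists>\<mu>. morse_tile_of n k \<sigma> \<mu> s" if "s \<in> T'" for s
    using tile[OF that] by blast
  show "partition_on S T'" by (rule partition_T')
  fix j
  define big where "big = (\<lambda>t :: 'a set. \<exists>n\<ge>j. \<exists>k \<sigma> \<mu>. morse_tile_of n k \<sigma> \<mu> t)"
  have big: "big s \<longleftrightarrow> big t" if "t \<in> T" "s \<in> set (g t)" for s t
    using g[OF that(1)] that(2) flag_tile_dim_iff unfolding subdivides_tile_def big_def by metis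
  have U: "\<Union>(set (g t)) = t" if "t \<in> T" for t using gD(2)[OF that] by (simp add: partition_on_def)
  have "\<Union>{s\<in>T'. big s} = \<Union>{t\<in>T. big t}"
  proof (intro equalityI subsetI)
    fix x assume "x \<in> \<Union>{s\<in>T'. big s}"
    then obtain s t where "x \<in> s" "big s" "t \<in> T" "s \<in> set (g t)" by (auto simp: T'_def)
    then show "x \<in> \<Union>{t\<in>T. big t}" using big piece_subset by blast
  next
    fix x assume "x \<in> \<Union>{t\<in>T. big t}"
    then obtain t where t: "x \<in> t" "t \<in> T" "big t" by blast
    then obtain s where "x \<in> s" "s \<in> set (g t)" using U by blast
    then show "x \<in> \<Union>{s\<in>T'. big s}" using big t by (auto simp: T'_def)
  qed
  moreover have "closedin (top_of_set S) (\<Union>{t\<in>T. big t})"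
    using tiling unfolding morse_tiling_def big_def by blast
  ultimately show "closedin (top_of_set S) (\<Union>{t\<in>T'. \<exists>n\<ge>j. \<exists>k \<sigma> \<mu>. morse_tile_of n k \<sigma> \<mu> t})"
    by (simp add: big_def)
qed

lemma tame': "tame_tiling (barycentric_subdivision L) S T'"
  by (rule tame_tiling_flag_tiles[OF complex_L flag_tiles])

text \<open>
  Every critical tile contains exactly one piece that is critical of the same index, and these are all the
  critical pieces.
\<close>

lemma critical_card: "card {s\<in>T'. critical_tile s i} = card {t\<in>T. critical_tile t i}"
proof -
  define c where "c t = (THE s. s \<in> set (g t) \<and> critical_tile s i)" for t
  have c1: "{s\<in>set (g t). critical_tile s i} = {c t}" if "t \<in> T" "critical_tile t i" for t
  proof -
    have "card {s\<in>set (g t). critical_tile s i} = 1" using gD(4)[OF that(1), of i] that(2) by simp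
    then obtain s where s: "{s\<in>set (g t). critical_tile s i} = {s}" by (rule card_1_singletonE)
    then have "c t = s" unfolding c_def by (intro the_equality) blast+
    then show ?thesis using s by simp
  qed
  have c0: "\<not> critical_tile s i" if "t \<in> T" "\<not> critical_tile t i" "s \<in> set (g t)" for s t
    using gD(4)[OF that(1), of i] that(2,3) by auto
  have "bij_betw c {t\<in>T. critical_tile t i} {s\<in>T'. critical_tile s i}"
    unfolding bij_betw_def
  proof
    have mem: "c t \<in> set (g t)" "critical_tile (c t) i" if "t \<in> T" "critical_tile t i" for t
      using c1[OF that] by blast+
    show "inj_on c {t\<in>T. critical_tile t i}"
    proof (rule inj_onI)
      fix t t' assume "t \<in> {t\<in>T. critical_tile t i}" "t' \<in> {t\<in>T. critical_tile t i}" "c t = c t'"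
      then show "t = t'" using g_disjoint[of t t' "c t"] mem[of t] mem[of t'] by simp
    qed
    show "c ` {t\<in>T. critical_tile t i} = {s\<in>T'. critical_tile s i}"
    proof (intro equalityI subsetI)
      fix s assume "s \<in> {s\<in>T'. critical_tile s i}"
      then obtain t where t: "t \<in> T" "s \<in> set (g t)" "critical_tile s i" by (auto simp: T'_def)
      then have "critical_tile t i" using c0 by blast
      then have "s = c t" using c1 t by blast
      then show "s \<in> c ` {t\<in>T. critical_tile t i}" using t \<open>critical_tile t i\<close> by blast
    qed (use mem in \<open>auto simp: T'_def\<close>)
  qed
  from bij_betw_same_card[OF this] show ?thesis by (rule sym)
qed

lemma shelling':
  assumes "morse_shelling K S T N A"
  shows "\<exists>N' A'. morse_shelling (barycentric_subdivision L) S T' N' A'"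
proof -
  obtain ts where ts: "distinct ts" "set ts = T" "ts \<noteq> []" "closed_prefixes ts"
    using morse_shelling_imp_list[OF assms] .
  define us where "us = concat (map g ts)"
  have gne: "g t \<noteq> []" if "t \<in> T" for t
  proof -
    have "t \<noteq> {}" using partition_T that by (auto simp: partition_on_def)
    then show ?thesis using gD(2)[OF that] by (auto simp: partition_on_def)
  qed
  have "set us = T'" by (simp add: us_def T'_def ts(2))
  moreover have "us \<noteq> []" using ts gne by (cases ts) (auto simp: us_def)
  moreover have "distinct us"
    unfolding us_def
  proof (rule distinct_concat)
    have "inj_on g T"
    proof (rule inj_onI)
      fix t t' assume tt: "t \<in> T" "t' \<in> T" "g t = g t'"
      obtain s where "s \<in> set (g t)" using gne[OF tt(1)] by (cases "g t") auto
      then show "t = t'" using g_disjoint[OF tt(1,2)] tt(3) by simp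
    qed
    then show "distinct (map g ts)" using ts by (simp add: distinct_map)
    show "distinct ys" if "ys \<in> set (map g ts)" for ys using that gD(1) ts(2) by auto
    show "set ys \<inter> set zs = {}" if "ys \<in> set (map g ts)" "zs \<in> set (map g ts)" "ys \<noteq> zs" for ys zs
      using that g_disjoint ts(2) by fastforce
  qed
  moreover have "closed_prefixes us"
    unfolding us_def
  proof (rule closed_prefixes_concat[OF ts(4)])
    show "closed_prefixes (g t) \<and> \<Union>(set (g t)) = t" if "t \<in> set ts" for t
      using gD(2,3) that ts(2) by (auto simp: partition_on_def)
  qed
  ultimately show ?thesis using list_imp_morse_shelling[OF tiling'] by blast
qed

end

lemma ex_tiled_subdivision:
  assumes "morse_tiling K S T"
  shows "\<exists>g. tiled_subdivision K S T g"
proof -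
  have "\<forall>t\<in>T. \<exists>ts. subdivides_tile (underlying_complex K S) t ts" using ex_subdivides_tile[OF assms] by blast
  then obtain g where "\<forall>t\<in>T. subdivides_tile (underlying_complex K S) t (g t)" by metis
  then show ?thesis using assms by (auto simp: tiled_subdivision_def)
qed

theorem proposition2p14:
  fixes K :: "'a::euclidean_space set set" and S :: "'a set" and T :: "'a set set"
  defines "K' \<equiv> barycentric_subdivision (underlying_complex K S)"
  shows
    "(morse_tiling K S T \<longrightarrow>
        (\<exists>T'. morse_tiling K' S T' \<and> tame_tiling K' S T' \<and>
           (\<forall>i. card {t \<in> T'. critical_tile t i} = card {t \<in> T. critical_tile t i}))) \<and>
     (\<forall>N A. morse_shelling K S T N A \<longrightarrow>
        (\<exists>T' N' A'. morse_shelling K' S T' N' A' \<and> tame_tiling K' S T' \<and>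
           (\<forall>i. card {t \<in> T'. critical_tile t i} = card {t \<in> T. critical_tile t i})))"
proof (intro conjI impI allI)
  assume "morse_tiling K S T"
  then obtain g where "tiled_subdivision K S T g" using ex_tiled_subdivision by blast
  then interpret tiled_subdivision K S T g .
  show "\<exists>T'. morse_tiling K' S T' \<and> tame_tiling K' S T' \<and>
      (\<forall>i. card {t \<in> T'. critical_tile t i} = card {t \<in> T. critical_tile t i})"
    using tiling' tame' critical_card unfolding K'_def by blast
next
  fix N A assume sh: "morse_shelling K S T N A"
  then have "morse_tiling K S T" by (simp add: morse_shelling_def)
  then obtain g where "tiled_subdivision K S T g" using ex_tiled_subdivision by blast
  then interpret tiled_subdivision K S T g .
  show "\<exists>T' N' A'. morse_shelling K' S T' N' A' \<and> tame_tiling K' S T' \<and>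
      (\<forall>i. card {t \<in> T'. critical_tile t i} = card {t \<in> T. critical_tile t i})"
    using shelling'[OF sh] tame' critical_card unfolding K'_def by blast
qed

end
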